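(* Let $(X,\leq_X)$ be a preorder with decidable order relation. It is provable in $\mathsf{PA}^\omega$ that $\mathrm{Ram}(X)\wedge\mathrm{MB}(X^\ast)\to\mathrm{WQO}(X^\ast)$.
   Context: $\mathsf{PA}^\omega$ is Peano arithmetic in all finite types. $X^\ast$ is the set of finite words over $X$ with the embeddability preorder: $\langle x_0,\ldots,x_{m-1}\rangle\leq_{X^\ast}\langle x'_0,\ldots,x'_{n-1}\rangle$ iff there is a strictly increasing $f\colon\{0,\ldots,m-1\}\to\{0,\ldots,n-1\}$ with $x_i\leq_X x'_{f(i)}$ for all $i<m$. For a sequence $\alpha$, $\alpha[n]$ is its initial segment of length $n$. For words $a,b$, $a\lhd b$ means $a$ is a proper prefix of $b$. For sequences of words $q,v$, $q<_n v$ means $q[n]=v[n]$ and $q_n\lhd v_n$. For a sequence of words $v$, $\theta(v,j)$ means $\forall i_0<i_1\leq j\,(v_{i_0}\not\leq_{X^\ast}v_{i_1})$. Define: $\mathrm{WQO}(X^\ast):\equiv\forall u\in(X^\ast)^\omega\,\exists j\,\neg\theta(u,j)$; $\mathrm{Ram}(X):\equiv\forall x\in X^\omega\,\exists g\colon\mathbb{N}\to\mathbb{N}\,\forall k\,\forall i<j\leq k\,(g i<g j\wedge x_{gi}\leq_X x_{gj})$; $\mathrm{MB}(X^\ast)$: for every $u\in(X^\ast)^\omega$ there exist a sequence $\mathbf{p}^0,\mathbf{p}^1,\ldots$ of elements of $(X^\ast)^\omega$ and a sequence $\mathbf{f}^0,\mathbf{f}^1,\ldots$ of functions $(X^\ast)^\omega\to\mathbb{N}$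 such that, with $\mathbf{p}^{-1}:=u$, for all $n,j$ and all $q\in(X^\ast)^\omega$: $\mathbf{p}^{n-1}[n]=\mathbf{p}^n[n]$, and $\theta(\mathbf{p}^{n-1},j)\to\theta(\mathbf{p}^n,j)$, and $q<_n\mathbf{p}^n\to\neg\theta(q,\mathbf{f}^n q)$. *)

theory Defs
  imports Main
begin

section \<open>The language of Peano arithmetic in all finite types\<close>

text \<open>
  Finite types are closed under function spaces, products and finite sequences.
  The types \<open>Atom k\<close> are uninterpreted: no axiom speaks about them, so they stand for
  arbitrary (non-empty) sets and may be replaced throughout a derivation by any other type.
\<close>

datatype ty =
    Nat ("\<N>")
  | Atom nat
  | Fun ty ty (infixr "\<rightarrow>" 70)
  | Prod ty ty (infixr "\<otimes>" 75)
  | Seq ty ("_\<^sup>\<star>" [1000] 1000)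

abbreviation Omega :: "ty \<Rightarrow> ty" ("_\<^sup>\<omega>" [1000] 1000) where
  "\<sigma>\<^sup>\<omega> \<equiv> \<N> \<rightarrow> \<sigma>"

text \<open>
  \<open>R\<close> and \<open>L\<close> are the recursors for numbers and for finite sequences; sequences are
  generated from the empty sequence by appending one element at the end (\<open>Ext\<close>).
\<close>

datatype con =
    Zero | Succ | R ty
  | K ty ty | S ty ty ty
  | Pr ty ty | Fst ty ty | Snd ty ty
  | Empty ty | Ext ty | L ty ty
  | Pt nat

fun cty :: "con \<Rightarrow> ty" where
  "cty Zero = \<N>"
| "cty Succ = \<N> \<rightarrow> \<N>"
| "cty (R \<sigma>) = \<sigma> \<rightarrow> (\<sigma> \<rightarrow> \<N> \<rightarrow> \<sigma>) \<rightarrow> \<N> \<rightarrow> \<sigma>"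
| "cty (K \<sigma> \<tau>) = \<sigma> \<rightarrow> \<tau> \<rightarrow> \<sigma>"
| "cty (S \<rho> \<sigma> \<tau>) = (\<rho> \<rightarrow> \<sigma> \<rightarrow> \<tau>) \<rightarrow> (\<rho> \<rightarrow> \<sigma>) \<rightarrow> \<rho> \<rightarrow> \<tau>"
| "cty (Pr \<sigma> \<tau>) = \<sigma> \<rightarrow> \<tau> \<rightarrow> \<sigma> \<otimes> \<tau>"
| "cty (Fst \<sigma> \<tau>) = \<sigma> \<otimes> \<tau> \<rightarrow> \<sigma>"
| "cty (Snd \<sigma> \<tau>) = \<sigma> \<otimes> \<tau> \<rightarrow> \<tau>"
| "cty (Empty \<sigma>) = \<sigma>\<^sup>\<star>"
| "cty (Ext \<sigma>) = \<sigma>\<^sup>\<star> \<rightarrow> \<sigma> \<rightarrow> \<sigma>\<^sup>\<star>"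
| "cty (L \<sigma> \<tau>) = \<tau> \<rightarrow> (\<tau> \<rightarrow> \<sigma>\<^sup>\<star> \<rightarrow> \<sigma> \<rightarrow> \<tau>) \<rightarrow> \<sigma>\<^sup>\<star> \<rightarrow> \<tau>"
| "cty (Pt k) = Atom k"

type_synonym var = "string \<times> ty"

datatype trm = V var | C con | App trm trm (infixl "\<cdot>" 90)

fun tyof :: "trm \<Rightarrow> ty" where
  "tyof (V x) = snd x"
| "tyof (C c) = cty c"
| "tyof (s \<cdot> t) = (case tyof s of \<sigma> \<rightarrow> \<tau> \<Rightarrow> \<tau> | _ \<Rightarrow> \<N>)"

fun wt :: "trm \<Rightarrow> bool" where
  "wt (V x) \<longleftrightarrow> True"
| "wt (C c) \<longleftrightarrow> True"
| "wt (s \<cdot> t) \<longleftrightarrow> wt s \<and> wt t \<and> tyof s = tyof t \<rightarrow> tyof (s \<cdot> t)"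

definition hasty :: "trm \<Rightarrow> ty \<Rightarrow> bool" (infix "\<Colon>" 50) where
  "t \<Colon> \<sigma> \<longleftrightarrow> wt t \<and> tyof t = \<sigma>"

fun tfv :: "trm \<Rightarrow> var set" where
  "tfv (V x) = {x}"
| "tfv (C c) = {}"
| "tfv (s \<cdot> t) = tfv s \<union> tfv t"

fun tsubst :: "var \<Rightarrow> trm \<Rightarrow> trm \<Rightarrow> trm" where
  "tsubst x r (V y) = (if y = x then r else V y)"
| "tsubst x r (C c) = C c"
| "tsubst x r (s \<cdot> t) = tsubst x r s \<cdot> tsubst x r t"

datatype fm =
    Eq trm trm (infix "\<doteq>" 55)
  | Bot ("\<^bold>\<bottom>")
  | And fm fm (infixr "\<^bold>\<and>" 45)
  | Or fm fm (infixr "\<^bold>\<or>" 44)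
  | Imp fm fm (infixr "\<^bold>\<longrightarrow>" 43)
  | Forall var fm ("(3\<^bold>\<forall>_./ _)" [0, 42] 42)
  | Exists var fm ("(3\<^bold>\<exists>_./ _)" [0, 42] 42)

abbreviation Neg :: "fm \<Rightarrow> fm" ("\<^bold>\<not> _" [50] 50) where
  "\<^bold>\<not> A \<equiv> A \<^bold>\<longrightarrow> \<^bold>\<bottom>"

fun wff :: "fm \<Rightarrow> bool" where
  "wff (s \<doteq> t) \<longleftrightarrow> wt s \<and> wt t \<and> tyof s = tyof t"
| "wff \<^bold>\<bottom> \<longleftrightarrow> True"
| "wff (A \<^bold>\<and> B) \<longleftrightarrow> wff A \<and> wff B"
| "wff (A \<^bold>\<or> B) \<longleftrightarrow> wff A \<and> wff B"
| "wff (A \<^bold>\<longrightarrow> B) \<longleftrightarrow> wff A \<and> wff B"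
| "wff (\<^bold>\<forall>x. A) \<longleftrightarrow> wff A"
| "wff (\<^bold>\<exists>x. A) \<longleftrightarrow> wff A"

fun fv :: "fm \<Rightarrow> var set" where
  "fv (s \<doteq> t) = tfv s \<union> tfv t"
| "fv \<^bold>\<bottom> = {}"
| "fv (A \<^bold>\<and> B) = fv A \<union> fv B"
| "fv (A \<^bold>\<or> B) = fv A \<union> fv B"
| "fv (A \<^bold>\<longrightarrow> B) = fv A \<union> fv B"
| "fv (\<^bold>\<forall>x. A) = fv A - {x}"
| "fv (\<^bold>\<exists>x. A) = fv A - {x}"

text \<open>Substitution does not rename; it is only used under the proviso \<open>free_for\<close>.\<close>

fun subst :: "var \<Rightarrow> trm \<Rightarrow> fm \<Rightarrow> fm" where
  "subst x r (s \<doteq> t) = (tsubst x r s \<doteq> tsubst x r t)"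
| "subst x r \<^bold>\<bottom> = \<^bold>\<bottom>"
| "subst x r (A \<^bold>\<and> B) = (subst x r A \<^bold>\<and> subst x r B)"
| "subst x r (A \<^bold>\<or> B) = (subst x r A \<^bold>\<or> subst x r B)"
| "subst x r (A \<^bold>\<longrightarrow> B) = (subst x r A \<^bold>\<longrightarrow> subst x r B)"
| "subst x r (\<^bold>\<forall>y. A) = (\<^bold>\<forall>y. (if y = x then A else subst x r A))"
| "subst x r (\<^bold>\<exists>y. A) = (\<^bold>\<exists>y. (if y = x then A else subst x r A))"

fun free_for :: "trm \<Rightarrow> var \<Rightarrow> fm \<Rightarrow> bool" where
  "free_for r x (s \<doteq> t) \<longleftrightarrow> True"
| "free_for r x \<^bold>\<bottom> \<longleftrightarrow> True"
| "free_for r x (A \<^bold>\<and> B) \<longleftrightarrow> free_for r x A \<and> free_for r x B"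
| "free_for r x (A \<^bold>\<or> B) \<longleftrightarrow> free_for r x A \<and> free_for r x B"
| "free_for r x (A \<^bold>\<longrightarrow> B) \<longleftrightarrow> free_for r x A \<and> free_for r x B"
| "free_for r x (\<^bold>\<forall>y. A) \<longleftrightarrow> x \<notin> fv (\<^bold>\<forall>y. A) \<or> (y \<notin> tfv r \<and> free_for r x A)"
| "free_for r x (\<^bold>\<exists>y. A) \<longleftrightarrow> x \<notin> fv (\<^bold>\<exists>y. A) \<or> (y \<notin> tfv r \<and> free_for r x A)"


section \<open>Derivability\<close>

text \<open>
  Every type has a primitive equality satisfying reflexivity and replacement; extensionality
  is not assumed. This is the neutral theory of Troelstra together with classical logic, so
  whatever is derivable here is derivable in the extensional theory as well. That \<open>Ext\<close> is
  injective and never yields the empty sequence follows from the recursor equations.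
\<close>

inductive_set pa_ax :: "fm set" where
  refl: "wt t \<Longrightarrow> (t \<doteq> t) \<in> pa_ax"
| K: "\<lbrakk>s \<Colon> \<sigma>; t \<Colon> \<tau>\<rbrakk> \<Longrightarrow> (C (K \<sigma> \<tau>) \<cdot> s \<cdot> t \<doteq> s) \<in> pa_ax"
| S: "\<lbrakk>r \<Colon> \<rho> \<rightarrow> \<sigma> \<rightarrow> \<tau>; s \<Colon> \<rho> \<rightarrow> \<sigma>; t \<Colon> \<rho>\<rbrakk>
    \<Longrightarrow> (C (S \<rho> \<sigma> \<tau>) \<cdot> r \<cdot> s \<cdot> t \<doteq> r \<cdot> t \<cdot> (s \<cdot> t)) \<in> pa_ax"
| fst: "\<lbrakk>s \<Colon> \<sigma>; t \<Colon> \<tau>\<rbrakk> \<Longrightarrow> (C (Fst \<sigma> \<tau>) \<cdot> (C (Pr \<sigma> \<tau>) \<cdot> s \<cdot> t) \<doteq> s) \<in> pa_ax"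
| snd: "\<lbrakk>s \<Colon> \<sigma>; t \<Colon> \<tau>\<rbrakk> \<Longrightarrow> (C (Snd \<sigma> \<tau>) \<cdot> (C (Pr \<sigma> \<tau>) \<cdot> s \<cdot> t) \<doteq> t) \<in> pa_ax"
| pair: "t \<Colon> \<sigma> \<otimes> \<tau>
    \<Longrightarrow> (C (Pr \<sigma> \<tau>) \<cdot> (C (Fst \<sigma> \<tau>) \<cdot> t) \<cdot> (C (Snd \<sigma> \<tau>) \<cdot> t) \<doteq> t) \<in> pa_ax"
| R0: "\<lbrakk>s \<Colon> \<sigma>; t \<Colon> \<sigma> \<rightarrow> \<N> \<rightarrow> \<sigma>\<rbrakk> \<Longrightarrow> (C (R \<sigma>) \<cdot> s \<cdot> t \<cdot> C Zero \<doteq> s) \<in> pa_ax"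
| RS: "\<lbrakk>s \<Colon> \<sigma>; t \<Colon> \<sigma> \<rightarrow> \<N> \<rightarrow> \<sigma>; n \<Colon> \<N>\<rbrakk>
    \<Longrightarrow> (C (R \<sigma>) \<cdot> s \<cdot> t \<cdot> (C Succ \<cdot> n) \<doteq> t \<cdot> (C (R \<sigma>) \<cdot> s \<cdot> t \<cdot> n) \<cdot> n) \<in> pa_ax"
| L0: "\<lbrakk>s \<Colon> \<tau>; t \<Colon> \<tau> \<rightarrow> \<sigma>\<^sup>\<star> \<rightarrow> \<sigma> \<rightarrow> \<tau>\<rbrakk>
    \<Longrightarrow> (C (L \<sigma> \<tau>) \<cdot> s \<cdot> t \<cdot> C (Empty \<sigma>) \<doteq> s) \<in> pa_ax"
| LE: "\<lbrakk>s \<Colon> \<tau>; t \<Colon> \<tau> \<rightarrow> \<sigma>\<^sup>\<star> \<rightarrow> \<sigma> \<rightarrow> \<tau>; a \<Colon> \<sigma>\<^sup>\<star>; b \<Colon> \<sigma>\<rbrakk>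
    \<Longrightarrow> (C (L \<sigma> \<tau>) \<cdot> s \<cdot> t \<cdot> (C (Ext \<sigma>) \<cdot> a \<cdot> b) \<doteq> t \<cdot> (C (L \<sigma> \<tau>) \<cdot> s \<cdot> t \<cdot> a) \<cdot> a \<cdot> b) \<in> pa_ax"
| Succ_Zero: "n \<Colon> \<N> \<Longrightarrow> (\<^bold>\<not> (C Succ \<cdot> n \<doteq> C Zero)) \<in> pa_ax"
| Succ_inj: "\<lbrakk>m \<Colon> \<N>; n \<Colon> \<N>\<rbrakk> \<Longrightarrow> (C Succ \<cdot> m \<doteq> C Succ \<cdot> n \<^bold>\<longrightarrow> m \<doteq> n) \<in> pa_ax"

inductive pa :: "fm set \<Rightarrow> fm \<Rightarrow> bool" (infix "\<turnstile>" 40) where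
  Assume: "\<lbrakk>A \<in> \<Gamma>; wff A\<rbrakk> \<Longrightarrow> \<Gamma> \<turnstile> A"
| Weaken: "\<lbrakk>\<Gamma> \<turnstile> A; \<Gamma> \<subseteq> \<Delta>\<rbrakk> \<Longrightarrow> \<Delta> \<turnstile> A"
| Ax: "A \<in> pa_ax \<Longrightarrow> \<Gamma> \<turnstile> A"
| AndI: "\<lbrakk>\<Gamma> \<turnstile> A; \<Gamma> \<turnstile> B\<rbrakk> \<Longrightarrow> \<Gamma> \<turnstile> A \<^bold>\<and> B"
| AndE1: "\<Gamma> \<turnstile> A \<^bold>\<and> B \<Longrightarrow> \<Gamma> \<turnstile> A"
| AndE2: "\<Gamma> \<turnstile> A \<^bold>\<and> B \<Longrightarrow> \<Gamma> \<turnstile> B"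
| OrI1: "\<lbrakk>\<Gamma> \<turnstile> A; wff B\<rbrakk> \<Longrightarrow> \<Gamma> \<turnstile> A \<^bold>\<or> B"
| OrI2: "\<lbrakk>\<Gamma> \<turnstile> B; wff A\<rbrakk> \<Longrightarrow> \<Gamma> \<turnstile> A \<^bold>\<or> B"
| OrE: "\<lbrakk>\<Gamma> \<turnstile> A \<^bold>\<or> B; insert A \<Gamma> \<turnstile> D; insert B \<Gamma> \<turnstile> D\<rbrakk> \<Longrightarrow> \<Gamma> \<turnstile> D"
| ImpI: "\<lbrakk>insert A \<Gamma> \<turnstile> B; wff A\<rbrakk> \<Longrightarrow> \<Gamma> \<turnstile> A \<^bold>\<longrightarrow> B"
| ImpE: "\<lbrakk>\<Gamma> \<turnstile> A \<^bold>\<longrightarrow> B; \<Gamma> \<turnstile> A\<rbrakk> \<Longrightarrow> \<Gamma> \<turnstile> B"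
| Classical: "\<lbrakk>insert (\<^bold>\<not> A) \<Gamma> \<turnstile> \<^bold>\<bottom>; wff A\<rbrakk> \<Longrightarrow> \<Gamma> \<turnstile> A"
| AllI: "\<lbrakk>\<Gamma> \<turnstile> A; \<forall>B\<in>\<Gamma>. x \<notin> fv B\<rbrakk> \<Longrightarrow> \<Gamma> \<turnstile> \<^bold>\<forall>x. A"
| AllE: "\<lbrakk>\<Gamma> \<turnstile> \<^bold>\<forall>x. A; t \<Colon> snd x; free_for t x A\<rbrakk> \<Longrightarrow> \<Gamma> \<turnstile> subst x t A"
| ExI: "\<lbrakk>\<Gamma> \<turnstile> subst x t A; t \<Colon> snd x; free_for t x A; wff A\<rbrakk> \<Longrightarrow> \<Gamma> \<turnstile> \<^bold>\<exists>x. A"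
| ExE: "\<lbrakk>\<Gamma> \<turnstile> \<^bold>\<exists>x. A; insert A \<Gamma> \<turnstile> B; x \<notin> fv B; \<forall>D\<in>\<Gamma>. x \<notin> fv D\<rbrakk> \<Longrightarrow> \<Gamma> \<turnstile> B"
| Replace: "\<lbrakk>\<Gamma> \<turnstile> s \<doteq> t; \<Gamma> \<turnstile> subst x s A; s \<Colon> snd x; free_for s x A; free_for t x A; wff A\<rbrakk>
    \<Longrightarrow> \<Gamma> \<turnstile> subst x t A"
| Induct: "\<lbrakk>\<Gamma> \<turnstile> subst x (C Zero) A; \<Gamma> \<turnstile> \<^bold>\<forall>x. A \<^bold>\<longrightarrow> subst x (C Succ \<cdot> V x) A; snd x = \<N>\<rbrakk>
    \<Longrightarrow> \<Gamma> \<turnstile> \<^bold>\<forall>x. A"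
| Seq_Induct: "\<lbrakk>\<Gamma> \<turnstile> subst x (C (Empty \<sigma>)) A;
     \<Gamma> \<turnstile> \<^bold>\<forall>x. \<^bold>\<forall>y. A \<^bold>\<longrightarrow> subst x (C (Ext \<sigma>) \<cdot> V x \<cdot> V y) A;
     snd x = \<sigma>\<^sup>\<star>; snd y = \<sigma>; y \<notin> fv A; free_for (C (Ext \<sigma>) \<cdot> V x \<cdot> V y) x A\<rbrakk>
    \<Longrightarrow> \<Gamma> \<turnstile> \<^bold>\<forall>x. A"


section \<open>Defined terms\<close>

text \<open>\<open>lam x t\<close> is combinatory abstraction: \<open>lam x t \<cdot> s\<close> is provably equal to \<open>tsubst x s t\<close>.\<close>

fun lam :: "var \<Rightarrow> trm \<Rightarrow> trm" ("(3\<^bold>\<lambda>_./ _)" [0, 85] 85) where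
  "lam x (V y) = (if y = x
     then C (S (snd x) (snd x \<rightarrow> snd x) (snd x)) \<cdot> C (K (snd x) (snd x \<rightarrow> snd x))
            \<cdot> C (K (snd x) (snd x))
     else C (K (snd y) (snd x)) \<cdot> V y)"
| "lam x (C c) = C (K (cty c) (snd x)) \<cdot> C c"
| "lam x (s \<cdot> t) = (if x \<in> tfv (s \<cdot> t)
     then C (S (snd x) (tyof t) (tyof (s \<cdot> t))) \<cdot> lam x s \<cdot> lam x t
     else C (K (tyof (s \<cdot> t)) (snd x)) \<cdot> (s \<cdot> t))"

text \<open>Below, the defining terms are closed, so that applying them cannot capture variables.\<close>

definition pred_t :: trm where
  "pred_t = (let r = (''r'', \<N>); k = (''k'', \<N>) in
     C (R \<N>) \<cdot> C Zero \<cdot> (\<^bold>\<lambda>r. \<^bold>\<lambda>k. V k))"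

definition monus_t :: trm where
  "monus_t = (let m = (''m'', \<N>); r = (''r'', \<N>); k = (''k'', \<N>) in
     \<^bold>\<lambda>m. C (R \<N>) \<cdot> V m \<cdot> (\<^bold>\<lambda>r. \<^bold>\<lambda>k. pred_t \<cdot> V r))"

definition le_fm :: "trm \<Rightarrow> trm \<Rightarrow> fm" (infix "\<preceq>" 55) where
  "m \<preceq> n = (monus_t \<cdot> m \<cdot> n \<doteq> C Zero)"

definition less_fm :: "trm \<Rightarrow> trm \<Rightarrow> fm" (infix "\<prec>" 55) where
  "m \<prec> n = (C Succ \<cdot> m \<preceq> n)"

definition len_t :: "ty \<Rightarrow> trm" where
  "len_t \<sigma> = (let r = (''r'', \<N>); a = (''a'', \<sigma>\<^sup>\<star>); x = (''x'', \<sigma>) in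
     C (L \<sigma> \<N>) \<cdot> C Zero \<cdot> (\<^bold>\<lambda>r. \<^bold>\<lambda>a. \<^bold>\<lambda>x. C Succ \<cdot> V r))"

definition append_t :: "ty \<Rightarrow> trm" where
  "append_t \<sigma> = (let a = (''a'', \<sigma>\<^sup>\<star>); r = (''r'', \<sigma>\<^sup>\<star>); b = (''b'', \<sigma>\<^sup>\<star>); x = (''x'', \<sigma>) in
     \<^bold>\<lambda>a. C (L \<sigma> \<sigma>\<^sup>\<star>) \<cdot> V a \<cdot> (\<^bold>\<lambda>r. \<^bold>\<lambda>b. \<^bold>\<lambda>x. C (Ext \<sigma>) \<cdot> V r \<cdot> V x))"

fun zero_t :: "ty \<Rightarrow> trm" where
  "zero_t \<N> = C Zero"
| "zero_t (Atom k) = C (Pt k)"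
| "zero_t (\<sigma> \<rightarrow> \<tau>) = C (K \<tau> \<sigma>) \<cdot> zero_t \<tau>"
| "zero_t (\<sigma> \<otimes> \<tau>) = C (Pr \<sigma> \<tau>) \<cdot> zero_t \<sigma> \<cdot> zero_t \<tau>"
| "zero_t (\<sigma>\<^sup>\<star>) = C (Empty \<sigma>)"

text \<open>
  The entry of a finite sequence at a position: the entry of \<open>Ext a x\<close> at \<open>i\<close> is that of
  \<open>a\<close> if \<open>i < |a|\<close> (that is, if \<open>|a| - i > 0\<close>) and \<open>x\<close> otherwise. Values at
  positions beyond the length are irrelevant.
\<close>

definition nth_t :: "ty \<Rightarrow> trm" where
  "nth_t \<sigma> = (let r = (''r'', \<N> \<rightarrow> \<sigma>); a = (''a'', \<sigma>\<^sup>\<star>); x = (''x'', \<sigma>); i = (''i'', \<N>);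
        y = (''y'', \<sigma>); k = (''k'', \<N>) in
     C (L \<sigma> (\<N> \<rightarrow> \<sigma>)) \<cdot> zero_t (\<N> \<rightarrow> \<sigma>) \<cdot>
       (\<^bold>\<lambda>r. \<^bold>\<lambda>a. \<^bold>\<lambda>x. \<^bold>\<lambda>i. C (R \<sigma>) \<cdot> V x \<cdot> (\<^bold>\<lambda>y. \<^bold>\<lambda>k. V r \<cdot> V i) \<cdot> (monus_t \<cdot> (len_t \<sigma> \<cdot> V a) \<cdot> V i)))"

text \<open>The initial segment \<open>\<alpha>[n]\<close> of an infinite sequence, as a finite sequence.\<close>

definition init_t :: "ty \<Rightarrow> trm" where
  "init_t \<sigma> = (let \<alpha> = (''alpha'', \<sigma>\<^sup>\<omega>); r = (''r'', \<sigma>\<^sup>\<star>); k = (''k'', \<N>) in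
     \<^bold>\<lambda>\<alpha>. C (R \<sigma>\<^sup>\<star>) \<cdot> C (Empty \<sigma>) \<cdot> (\<^bold>\<lambda>r. \<^bold>\<lambda>k. C (Ext \<sigma>) \<cdot> V r \<cdot> (V \<alpha> \<cdot> V k)))"


section \<open>Well quasi-orders in the formal language\<close>

text \<open>
  The relation on a type \<open>X\<close> is given by a function variable \<open>le\<close>, which makes it
  decidable: \<open>x \<le> y\<close> holds if and only if \<open>le x y = 0\<close>. This variable is never bound
  below, so it is an arbitrary parameter. The variables bound in each formula have names that do
  not occur in the terms to which that formula is applied.
\<close>

definition le_var :: "ty \<Rightarrow> var" where
  "le_var X = (''le'', X \<rightarrow> X \<rightarrow> \<N>)"

definition leX :: "ty \<Rightarrow> trm \<Rightarrow> trm \<Rightarrow> fm" where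
  "leX X s t = (V (le_var X) \<cdot> s \<cdot> t \<doteq> C Zero)"

definition preorder_fm :: "ty \<Rightarrow> fm" where
  "preorder_fm X = (let x = (''x'', X); y = (''y'', X); z = (''z'', X) in
     (\<^bold>\<forall>x. leX X (V x) (V x)) \<^bold>\<and>
     (\<^bold>\<forall>x. \<^bold>\<forall>y. \<^bold>\<forall>z. leX X (V x) (V y) \<^bold>\<and> leX X (V y) (V z) \<^bold>\<longrightarrow> leX X (V x) (V z)))"

definition embeds :: "ty \<Rightarrow> trm \<Rightarrow> trm \<Rightarrow> fm" where
  "embeds X a b = (let h = (''h'', \<N> \<rightarrow> \<N>); i = (''i'', \<N>); k = (''k'', \<N>) in
     \<^bold>\<exists>h. (\<^bold>\<forall>i. V i \<prec> len_t X \<cdot> a \<^bold>\<longrightarrow> V h \<cdot> V i \<prec> len_t X \<cdot> b) \<^bold>\<and>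
          (\<^bold>\<forall>i. \<^bold>\<forall>k. V i \<prec> V k \<^bold>\<and> V k \<prec> len_t X \<cdot> a \<^bold>\<longrightarrow> V h \<cdot> V i \<prec> V h \<cdot> V k) \<^bold>\<and>
          (\<^bold>\<forall>i. V i \<prec> len_t X \<cdot> a \<^bold>\<longrightarrow> leX X (nth_t X \<cdot> a \<cdot> V i) (nth_t X \<cdot> b \<cdot> (V h \<cdot> V i))))"

definition proper_prefix :: "ty \<Rightarrow> trm \<Rightarrow> trm \<Rightarrow> fm" where
  "proper_prefix X a b = (let c = (''c'', X\<^sup>\<star>) in
     \<^bold>\<exists>c. \<^bold>\<not> (V c \<doteq> C (Empty X)) \<^bold>\<and> b \<doteq> append_t X \<cdot> a \<cdot> V c)"

definition lex_less :: "ty \<Rightarrow> trm \<Rightarrow> trm \<Rightarrow> trm \<Rightarrow> fm" where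
  "lex_less X n q v =
     (init_t X\<^sup>\<star> \<cdot> q \<cdot> n \<doteq> init_t X\<^sup>\<star> \<cdot> v \<cdot> n \<^bold>\<and> proper_prefix X (q \<cdot> n) (v \<cdot> n))"

definition theta :: "ty \<Rightarrow> trm \<Rightarrow> trm \<Rightarrow> fm" where
  "theta X v j = (let i0 = (''i0'', \<N>); i1 = (''i1'', \<N>) in
     \<^bold>\<forall>i0. \<^bold>\<forall>i1. V i0 \<prec> V i1 \<^bold>\<and> V i1 \<preceq> j \<^bold>\<longrightarrow> \<^bold>\<not> embeds X (v \<cdot> V i0) (v \<cdot> V i1))"

definition WQO :: "ty \<Rightarrow> fm" where
  "WQO X = (let u = (''u'', (X\<^sup>\<star>)\<^sup>\<omega>); j = (''j'', \<N>) in
     \<^bold>\<forall>u. \<^bold>\<exists>j. \<^bold>\<not> theta X (V u) (V j))"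

definition Ram :: "ty \<Rightarrow> fm" where
  "Ram X = (let x = (''x'', X\<^sup>\<omega>); g = (''g'', \<N> \<rightarrow> \<N>);
        k = (''k'', \<N>); i = (''i'', \<N>); j = (''j'', \<N>) in
     \<^bold>\<forall>x. \<^bold>\<exists>g. \<^bold>\<forall>k. \<^bold>\<forall>i. \<^bold>\<forall>j. V i \<prec> V j \<^bold>\<and> V j \<preceq> V k \<^bold>\<longrightarrow>
       V g \<cdot> V i \<prec> V g \<cdot> V j \<^bold>\<and> leX X (V x \<cdot> (V g \<cdot> V i)) (V x \<cdot> (V g \<cdot> V j)))"

text \<open>
  \<open>prev_t \<sigma> u p n\<close> is the element with index \<open>n - 1\<close> of the sequence \<open>p\<close>, where the
  element with index \<open>-1\<close> is \<open>u\<close>.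
\<close>

definition prev_t :: "ty \<Rightarrow> trm \<Rightarrow> trm \<Rightarrow> trm \<Rightarrow> trm" where
  "prev_t \<sigma> u p n = C (R \<sigma>) \<cdot> u \<cdot> (C (K (\<N> \<rightarrow> \<sigma>) \<sigma>) \<cdot> p) \<cdot> n"

definition MB :: "ty \<Rightarrow> fm" where
  "MB X = (let W = (X\<^sup>\<star>)\<^sup>\<omega>; u = (''u'', W); p = (''p'', W\<^sup>\<omega>); f = (''f'', (W \<rightarrow> \<N>)\<^sup>\<omega>);
        n = (''n'', \<N>); j = (''j'', \<N>); q = (''q'', W);
        pn = V p \<cdot> V n; pn1 = prev_t W (V u) (V p) (V n) in
     \<^bold>\<forall>u. \<^bold>\<exists>p. \<^bold>\<exists>f. \<^bold>\<forall>n. \<^bold>\<forall>j. \<^bold>\<forall>q.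
       init_t X\<^sup>\<star> \<cdot> pn1 \<cdot> V n \<doteq> init_t X\<^sup>\<star> \<cdot> pn \<cdot> V n \<^bold>\<and>
       (theta X pn1 (V j) \<^bold>\<longrightarrow> theta X pn (V j)) \<^bold>\<and>
       (lex_less X (V n) (V q) pn \<^bold>\<longrightarrow> \<^bold>\<not> theta X (V q) (V f \<cdot> V n \<cdot> V q)))"

end

theory Submission
  imports Defs "HOL-Library.Countable"
begin

text \<open>
  By a Henkin completeness theorem for the calculus, it suffices to show the formula true in
  every model: a typed combinatory structure in which induction holds for the predicates that
  are definable with parameters. There one can argue informally.

  Given a bad sequence \<open>u\<close>, all \<open>p n\<close> supplied by \<open>MB\<close> are bad, and so is their
  diagonal \<open>v n = p n n\<close>, since \<open>p n\<close> and \<open>v\<close> agree up to index \<open>n\<close>. No \<open>v n\<close> is empty;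
  split it as \<open>v n = w n * x n\<close> with last letter \<open>x n\<close>. If \<open>g\<close> is given by \<open>Ram\<close> for the sequence
  \<open>x\<close>, then \<open>q = v 0, \<dots>, v (g 0 - 1), w (g 0), w (g 1), \<dots>\<close> is lexicographically below
  \<open>p (g 0)\<close>, hence not bad. But any embedding between two entries of \<open>q\<close> yields one between two
  entries of \<open>v\<close>.
\<close>


section \<open>Syntax\<close>

text \<open>The obstacle is that numbers, words and functions of a model are elements of its
  domains, not HOL objects. Its numbers may be nonstandard, so even their order has to be recovered
  from the recursor equations, and every induction has to exhibit the formula that defines its
  predicate. Equality is not extensional: infinite sequences are compared only entry by entry, and
  each function built on the way (the sequence of last letters, an extended embedding, the sequence
  \<open>q\<close>) must be the value of an explicit combinatory term. What is gained is that
  contexts, eigenvariables and substitutions are dealt with once, in the completeness proof. Only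
  one letter is removed from each word \<open>v n\<close>: enough to make \<open>q\<close>
  lexicographically smaller, and so little that a single comparison of letters turns an embedding of
  the shortened words back into one of the original words.\<close>

instance ty :: countable by countable_datatype
instance con :: countable by countable_datatype
instance trm :: countable by countable_datatype
instance fm :: countable by countable_datatype

fun bv :: "fm \<Rightarrow> var set" where
  "bv (s \<doteq> t) = {}"
| "bv \<^bold>\<bottom> = {}"
| "bv (A \<^bold>\<and> B) = bv A \<union> bv B"
| "bv (A \<^bold>\<or> B) = bv A \<union> bv B"
| "bv (A \<^bold>\<longrightarrow> B) = bv A \<union> bv B"
| "bv (\<^bold>\<forall>x. A) = insert x (bv A)"
| "bv (\<^bold>\<exists>x. A) = insert x (bv A)"

lemma finite_tfv [simp]: "finite (tfv t)"
  by (induction t) auto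

lemma finite_fv [simp]: "finite (fv A)"
  by (induction A) auto

lemma finite_bv [simp]: "finite (bv A)"
  by (induction A) auto

text \<open>Simultaneous substitution, again without renaming.\<close>

fun tmsubst :: "(var \<Rightarrow> trm) \<Rightarrow> trm \<Rightarrow> trm" where
  "tmsubst e (V y) = e y"
| "tmsubst e (C c) = C c"
| "tmsubst e (s \<cdot> t) = tmsubst e s \<cdot> tmsubst e t"

fun msubst :: "(var \<Rightarrow> trm) \<Rightarrow> fm \<Rightarrow> fm" where
  "msubst e (s \<doteq> t) = (tmsubst e s \<doteq> tmsubst e t)"
| "msubst e \<^bold>\<bottom> = \<^bold>\<bottom>"
| "msubst e (A \<^bold>\<and> B) = (msubst e A \<^bold>\<and> msubst e B)"
| "msubst e (A \<^bold>\<or> B) = (msubst e A \<^bold>\<or> msubst e B)"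
| "msubst e (A \<^bold>\<longrightarrow> B) = (msubst e A \<^bold>\<longrightarrow> msubst e B)"
| "msubst e (\<^bold>\<forall>y. A) = (\<^bold>\<forall>y. msubst (e(y := V y)) A)"
| "msubst e (\<^bold>\<exists>y. A) = (\<^bold>\<exists>y. msubst (e(y := V y)) A)"

section \<open>Substitution, typing and capture\<close>

lemma tsubst_fresh [simp]: "x \<notin> tfv t \<Longrightarrow> tsubst x r t = t"
  by (induction t) auto

lemma tsubst_V_same [simp]: "tsubst x (V x) t = t"
  by (induction t) auto

lemma subst_fresh [simp]: "x \<notin> fv A \<Longrightarrow> subst x r A = A"
  by (induction A) auto

lemma subst_V_same [simp]: "subst x (V x) A = A"
  by (induction A) auto

lemma tmsubst_ident: "(\<And>y. y \<in> tfv t \<Longrightarrow> e y = V y) \<Longrightarrow> tmsubst e t = t"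
  by (induction t) auto

lemma msubst_ident: "(\<And>y. y \<in> fv A \<Longrightarrow> e y = V y) \<Longrightarrow> msubst e A = A"
  by (induction A arbitrary: e) (auto intro!: tmsubst_ident)

lemma tsubst_tmsubst:
  "\<lbrakk>e x = V x; \<And>y. y \<noteq> x \<Longrightarrow> x \<notin> tfv (e y)\<rbrakk> \<Longrightarrow> tsubst x t (tmsubst e s) = tmsubst (e(x := t)) s"
  by (induction s) auto

text \<open>This supports a two-step treatment of quantifiers: the variable \<open>x\<close> is
  first left open while all others receive their terms, and is instantiated afterwards. The
  freshness condition ensures that the second step hits only the occurrences left open. Below a
  binder of \<open>x\<close> itself both sides reset \<open>x\<close> to \<open>V x\<close>.\<close>

lemma subst_msubst:
  "\<lbrakk>e x = V x; \<And>y. y \<noteq> x \<Longrightarrow> x \<notin> tfv (e y)\<rbrakk> \<Longrightarrow> subst x t (msubst e A) = msubst (e(x := t)) A"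
proof (induction A arbitrary: e)
  case (Forall y A)
  show ?case
  proof (cases "y = x")
    case False
    then have "subst x t (msubst (e(y := V y)) A) = msubst ((e(y := V y))(x := t)) A"
      using Forall.prems by (intro Forall.IH) auto
    also have "(e(y := V y))(x := t) = (e(x := t))(y := V y)" using False by (rule fun_upd_twist)
    finally show ?thesis using False by (simp del: fun_upd_apply)
  qed (simp del: fun_upd_apply)
next
  case (Exists y A)
  show ?case
  proof (cases "y = x")
    case False
    then have "subst x t (msubst (e(y := V y)) A) = msubst ((e(y := V y))(x := t)) A"
      using Exists.prems by (intro Exists.IH) auto
    also have "(e(y := V y))(x := t) = (e(x := t))(y := V y)" using False by (rule fun_upd_twist)
    finally show ?thesis using False by (simp del: fun_upd_apply)
  qed (simp del: fun_upd_apply)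
qed (auto simp: tsubst_tmsubst)

lemma wt_tmsubst:
  "(\<And>y. e y \<Colon> snd y) \<Longrightarrow> wt (tmsubst e t) = wt t \<and> tyof (tmsubst e t) = tyof t"
  by (induction t) (auto simp: hasty_def)

lemma wff_msubst: "(\<And>y. e y \<Colon> snd y) \<Longrightarrow> wff (msubst e A) = wff A"
proof (induction A arbitrary: e)
  case (Eq s t)
  then show ?case using wt_tmsubst[of e] by simp
next
  case (Forall y A)
  then have "wff (msubst (e(y := V y)) A) = wff A" by (intro Forall.IH) (auto simp: hasty_def)
  then show ?case by simp
next
  case (Exists y A)
  then have "wff (msubst (e(y := V y)) A) = wff A" by (intro Exists.IH) (auto simp: hasty_def)
  then show ?case by simp
qed auto

lemma bv_msubst [simp]: "bv (msubst e A) = bv A"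
  by (induction A arbitrary: e) auto

lemma tfv_tmsubst: "tfv (tmsubst e t) = (\<Union>y\<in>tfv t. tfv (e y))"
  by (induction t) auto

lemma fv_msubst: "fv (msubst e A) \<subseteq> (\<Union>y\<in>fv A. tfv (e y))"
proof (induction A arbitrary: e)
  case (Forall x A)
  show ?case using Forall.IH[of "e(x := V x)"] by (fastforce split: if_splits)
next
  case (Exists x A)
  show ?case using Exists.IH[of "e(x := V x)"] by (fastforce split: if_splits)
qed (fastforce simp: tfv_tmsubst)+

text \<open>The variable \<open>x\<close> may be shared because below a binder of \<open>x\<close>
  there is no free occurrence left to replace. With bound variables outside \<open>Par\<close>, this
  discharges the proviso for all closed terms.\<close>

lemma free_for_disjoint: "tfv r \<inter> bv A \<subseteq> {x} \<Longrightarrow> free_for r x A"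
  by (induction A) auto

lemma free_for_V_same: "free_for (V x) x A"
  by (induction A) auto

lemma wt_tsubst: "r \<Colon> snd x \<Longrightarrow> wt (tsubst x r t) = wt t \<and> tyof (tsubst x r t) = tyof t"
  by (induction t) (auto simp: hasty_def)

lemma wff_subst: "r \<Colon> snd x \<Longrightarrow> wff (subst x r A) = wff A"
  by (induction A) (auto simp: wt_tsubst)

lemma bv_subst [simp]: "bv (subst x r A) = bv A"
  by (induction A) auto

lemma tfv_tsubst: "tfv (tsubst x r t) \<subseteq> tfv t - {x} \<union> tfv r"
  by (induction t) auto

lemma fv_subst: "fv (subst x r A) \<subseteq> fv A - {x} \<union> tfv r"
proof (induction A)
  case (Eq s t)
  then show ?case using tfv_tsubst[of x r s] tfv_tsubst[of x r t] by auto
qed auto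

lemma tsubst_tsubst_same: "tsubst x t (tsubst x r s) = tsubst x (tsubst x t r) s"
  by (induction s) auto

text \<open>Needed for instantiating an induction step: putting \<open>t\<close> for
  \<open>x\<close> in A(Succ x) gives A(Succ t).\<close>

lemma subst_subst_same: "subst x t (subst x r A) = subst x (tsubst x t r) A"
  by (induction A) (auto simp: tsubst_tsubst_same)

lemma tsubst_tsubst_other:
  "y \<notin> tfv s \<Longrightarrow> tsubst y t (tsubst x r s) = tsubst x (tsubst y t r) s"
  by (induction s) auto

lemma subst_subst_other:
  "y \<notin> fv A \<Longrightarrow> y \<notin> bv A \<Longrightarrow> subst y t (subst x r A) = subst x (tsubst y t r) A"
  by (induction A) (auto simp: tsubst_tsubst_other)

lemma free_for_rename_back:
  "c \<notin> fv A \<Longrightarrow> c \<notin> bv A \<Longrightarrow> free_for (V x) c (subst x (V c) A)"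
  by (induction A) auto


section \<open>Maximal consistent theories with witnesses\<close>

text \<open>
  Parameters play the role of Henkin constants. They include \<open>le_var X\<close>, and no variable bound
  in the formulas of interest is one of them, so closed terms can be substituted without capture.
\<close>

definition Par :: "var set" where
  "Par = {x. \<exists>s. fst x = CHR ''l'' # s}"

section \<open>Fresh parameters and the one-step extension\<close>

definition sentence :: "fm \<Rightarrow> bool" where
  "sentence A \<longleftrightarrow> wff A \<and> fv A \<subseteq> Par \<and> bv A \<inter> Par = {}"

definition closed_of :: "ty \<Rightarrow> trm set" where
  "closed_of \<sigma> = {t. t \<Colon> \<sigma> \<and> tfv t \<subseteq> Par}"

lemma fresh_param: "finite F \<Longrightarrow> \<exists>c. c \<in> Par \<and> snd c = \<sigma> \<and> c \<notin> F"
proof -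
  assume "finite F"
  let ?f = "\<lambda>n. (CHR ''l'' # replicate n CHR ''l'', \<sigma>)"
  have "infinite (range ?f)" by (subst finite_image_iff) (auto intro!: injI)
  with \<open>finite F\<close> obtain n where "?f n \<notin> F"
    by (metis finite_subset image_subsetI)
  then show ?thesis by (intro exI[of _ "?f n"]) (auto simp: Par_def)
qed

lemma fresh_nonparam: "finite F \<Longrightarrow> \<exists>c. c \<notin> Par \<and> snd c = \<sigma> \<and> c \<notin> F"
proof -
  assume "finite F"
  let ?f = "\<lambda>n. (CHR ''a'' # replicate n CHR ''a'', \<sigma>)"
  have "infinite (range ?f)" by (subst finite_image_iff) (auto intro!: injI)
  with \<open>finite F\<close> obtain n where "?f n \<notin> F"
    by (metis finite_subset image_subsetI)
  then show ?thesis by (intro exI[of _ "?f n"]) (auto simp: Par_def)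
qed

definition witness :: "fm set \<Rightarrow> var \<Rightarrow> fm \<Rightarrow> var" where
  "witness \<Gamma> x A = (SOME c. c \<in> Par \<and> snd c = snd x \<and> c \<notin> (\<Union>B\<in>\<Gamma>. fv B) \<union> fv A)"

lemma witness:
  assumes "finite \<Gamma>"
  shows "witness \<Gamma> x A \<in> Par" "snd (witness \<Gamma> x A) = snd x"
    "B \<in> \<Gamma> \<Longrightarrow> witness \<Gamma> x A \<notin> fv B" "witness \<Gamma> x A \<notin> fv A"
proof -
  have "finite ((\<Union>B\<in>\<Gamma>. fv B) \<union> fv A)" using assms by simp
  from someI_ex[OF fresh_param[OF this, of "snd x"]]
  show "witness \<Gamma> x A \<in> Par" "snd (witness \<Gamma> x A) = snd x"
    "B \<in> \<Gamma> \<Longrightarrow> witness \<Gamma> x A \<notin> fv B" "witness \<Gamma> x A \<notin> fv A"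
    unfolding witness_def by blast+
qed

text \<open>The fresh parameter acts as an eigenvariable: a refutation of the instance is
  generalised over \<open>c\<close>, and instantiating with \<open>x\<close> undoes the renaming and
  yields the negation of \<open>A\<close>. Then \<open>x\<close> can serve as eigenvariable of
  \<open>ExE\<close>, because it is not a parameter while the members of the theory have only
  parameters free.\<close>

lemma witness_consistent:
  assumes "(\<^bold>\<exists>x. A) \<in> \<Gamma>" and "sentence (\<^bold>\<exists>x. A)" and "\<forall>B\<in>\<Gamma>. sentence B"
    and c: "c \<in> Par" "snd c = snd x" "\<forall>B\<in>\<Gamma>. c \<notin> fv B" "c \<notin> fv A"
    and bot: "insert (subst x (V c) A) \<Gamma> \<turnstile> \<^bold>\<bottom>"
  shows "\<Gamma> \<turnstile> \<^bold>\<bottom>"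
proof -
  have wA: "wff A" and xP: "x \<notin> Par" and cb: "c \<notin> bv A"
    using assms(2) c(1) by (auto simp: sentence_def)
  have "\<Gamma> \<turnstile> \<^bold>\<not> subst x (V c) A"
    using bot wA c(2) by (intro pa.ImpI) (auto simp: wff_subst hasty_def)
  then have "\<Gamma> \<turnstile> \<^bold>\<forall>c. \<^bold>\<not> subst x (V c) A" using c(3) by (rule pa.AllI)
  then have "\<Gamma> \<turnstile> subst c (V x) (\<^bold>\<not> subst x (V c) A)"
    by (rule pa.AllE) (use c cb in \<open>auto simp: hasty_def free_for_rename_back\<close>)
  then have neg: "\<Gamma> \<turnstile> \<^bold>\<not> A" using c cb by (simp add: subst_subst_other)
  show ?thesis
  proof (rule pa.ExE)
    show "\<Gamma> \<turnstile> \<^bold>\<exists>x. A" using assms(1,2) by (intro pa.Assume) (auto simp: sentence_def)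
    have "insert A \<Gamma> \<turnstile> \<^bold>\<not> A" using neg by (rule pa.Weaken) auto
    then show "insert A \<Gamma> \<turnstile> \<^bold>\<bottom>" by (rule pa.ImpE) (use wA in \<open>auto intro: pa.Assume\<close>)
  qed (use xP assms(3) in \<open>auto simp: sentence_def\<close>)
qed

text \<open>A rejected sentence has its negation added at once, so that every sentence is decided at
  its own stage; an accepted existential sentence receives its witness in the same step.\<close>

definition extend :: "fm \<Rightarrow> fm set \<Rightarrow> fm set" where
  "extend A \<Gamma> = (if \<not> sentence A then \<Gamma>
     else if insert A \<Gamma> \<turnstile> \<^bold>\<bottom> then insert (\<^bold>\<not> A) \<Gamma>
     else (case A of \<^bold>\<exists>x. B \<Rightarrow> insert (subst x (V (witness (insert A \<Gamma>) x B)) B) (insert A \<Gamma>)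
           | _ \<Rightarrow> insert A \<Gamma>))"

definition good :: "fm set \<Rightarrow> bool" where
  "good \<Gamma> \<longleftrightarrow> finite \<Gamma> \<and> (\<forall>B\<in>\<Gamma>. sentence B) \<and> \<not> \<Gamma> \<turnstile> \<^bold>\<bottom>"

lemma sentence_subst:
  assumes "wff A" "fv A \<subseteq> insert x Par" "bv A \<inter> Par = {}" "t \<in> closed_of (snd x)"
  shows "sentence (subst x t A)"
  using assms fv_subst[of x t A] by (auto simp: sentence_def wff_subst closed_of_def)

lemma extend_good:
  assumes "good \<Gamma>"
  shows "good (extend A \<Gamma>)"
proof (cases "sentence A")
  case False
  then show ?thesis using assms by (simp add: extend_def)
next
  case sen: True
  show ?thesis
  proof (cases "insert A \<Gamma> \<turnstile> \<^bold>\<bottom>")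
    case True
    have "\<Gamma> \<turnstile> \<^bold>\<not> A" using True sen by (intro pa.ImpI) (auto simp: sentence_def)
    then have "\<not> insert (\<^bold>\<not> A) \<Gamma> \<turnstile> \<^bold>\<bottom>"
      using assms pa.ImpE[OF pa.ImpI] sen by (auto simp: good_def sentence_def)
    then show ?thesis using assms sen True by (auto simp: extend_def good_def sentence_def)
  next
    case False
    have g: "good (insert A \<Gamma>)" using assms False sen by (simp add: good_def)
    show ?thesis
    proof (cases "\<exists>x B. A = (\<^bold>\<exists>x. B)")
      case True
      then obtain x B where A: "A = (\<^bold>\<exists>x. B)" by blast
      let ?c = "witness (insert A \<Gamma>) x B"
      have fin: "finite (insert A \<Gamma>)" using g by (simp add: good_def)
      note w = witness[OF fin, where x = x and A = B]
      have "\<not> insert (subst x (V ?c) B) (insert A \<Gamma>) \<turnstile> \<^bold>\<bottom>"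
        using witness_consistent[of x B "insert A \<Gamma>" ?c] w g sen unfolding A good_def by blast
      moreover have "sentence (subst x (V ?c) B)"
        using sen w(1,2) unfolding A
        by (intro sentence_subst) (auto simp: sentence_def closed_of_def hasty_def)
      ultimately show ?thesis using g sen False by (simp add: extend_def A good_def)
    next
      case no: False
      then have "extend A \<Gamma> = insert A \<Gamma>" using sen False by (auto simp: extend_def split: fm.split)
      then show ?thesis using g by simp
    qed
  qed
qed

lemma extend_mono: "\<Gamma> \<subseteq> extend A \<Gamma>"
  by (auto simp: extend_def split: fm.split)

text \<open>Formulas form a countable type, so \<open>from_nat\<close> runs through all of them, and
  \<open>A\<close> is treated in the step from stage \<open>to_nat A\<close>.\<close>

fun stage :: "fm set \<Rightarrow> nat \<Rightarrow> fm set" where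
  "stage \<Gamma> 0 = \<Gamma>"
| "stage \<Gamma> (Suc n) = extend (from_nat n) (stage \<Gamma> n)"

text \<open>Contexts of \<open>pa\<close> may be infinite. Formulating consistency through finite
  subsets avoids a compactness argument on derivations: a finite subset of the union already lies in
  one stage.\<close>

locale henkin_theory =
  fixes T :: "fm set"
  assumes sentences: "A \<in> T \<Longrightarrow> sentence A"
    and consistent: "\<lbrakk>finite F; F \<subseteq> T\<rbrakk> \<Longrightarrow> \<not> F \<turnstile> \<^bold>\<bottom>"
    and complete: "sentence A \<Longrightarrow> A \<in> T \<or> (\<^bold>\<not> A) \<in> T"
    and witnessed: "(\<^bold>\<exists>x. A) \<in> T \<Longrightarrow> \<exists>t\<in>closed_of (snd x). subst x t A \<in> T"

lemma stage_mono: "m \<le> n \<Longrightarrow> stage \<Gamma> m \<subseteq> stage \<Gamma> n"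
  by (rule lift_Suc_mono_le[of "stage \<Gamma>"]) (simp_all add: extend_mono)

lemma henkin_extension:
  assumes "good \<Gamma>"
  shows "\<exists>T. henkin_theory T \<and> \<Gamma> \<subseteq> T"
proof (intro exI conjI)
  let ?T = "\<Union>n. stage \<Gamma> n"
  have good: "good (stage \<Gamma> n)" for n
    by (induction n) (simp_all add: assms extend_good)
  show "\<Gamma> \<subseteq> ?T" using UN_upper[of 0 UNIV "stage \<Gamma>"] by simp
  have sub: "\<exists>n. F \<subseteq> stage \<Gamma> n" if "finite F" "F \<subseteq> ?T" for F
    using that
  proof (induction F rule: finite_induct)
    case (insert A F)
    then obtain m n where "A \<in> stage \<Gamma> m" "F \<subseteq> stage \<Gamma> n" by auto
    then have "insert A F \<subseteq> stage \<Gamma> (max m n)"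
      using stage_mono[of m "max m n" \<Gamma>] stage_mono[of n "max m n" \<Gamma>] by auto
    then show ?case by blast
  qed simp
  have step: "extend A (stage \<Gamma> (to_nat A)) \<subseteq> ?T" for A
    using UN_upper[of "Suc (to_nat A)" UNIV "stage \<Gamma>"] by simp
  show "henkin_theory ?T"
  proof
    show "sentence A" if "A \<in> ?T" for A using that good by (auto simp: good_def)
    show con: "\<not> F \<turnstile> \<^bold>\<bottom>" if "finite F" "F \<subseteq> ?T" for F
    proof
      assume "F \<turnstile> \<^bold>\<bottom>"
      moreover obtain n where "F \<subseteq> stage \<Gamma> n" using sub \<open>finite F\<close> \<open>F \<subseteq> ?T\<close> by blast
      ultimately have "stage \<Gamma> n \<turnstile> \<^bold>\<bottom>" by (rule pa.Weaken)
      then show False using good by (simp add: good_def)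
    qed
    show "A \<in> ?T \<or> (\<^bold>\<not> A) \<in> ?T" if "sentence A" for A
    proof -
      have "A \<in> extend A (stage \<Gamma> (to_nat A)) \<or> (\<^bold>\<not> A) \<in> extend A (stage \<Gamma> (to_nat A))"
        using that by (auto simp: extend_def split: fm.split)
      then show ?thesis using step[of A] by blast
    qed
    show "\<exists>t\<in>closed_of (snd x). subst x t A \<in> ?T" if ex: "(\<^bold>\<exists>x. A) \<in> ?T" for x A
    proof -
      let ?E = "\<^bold>\<exists>x. A" let ?\<Delta> = "stage \<Gamma> (to_nat ?E)" let ?c = "witness (insert ?E ?\<Delta>) x A"
      have sen: "sentence ?E" using ex good by (auto simp: good_def)
      \<comment> \<open>An existential sentence of the union cannot have been rejected at its own
        stage, since the stage together with the sentence is a finite part of a consistent union. So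
        its witness was added there.\<close>
      have "\<not> insert ?E ?\<Delta> \<turnstile> \<^bold>\<bottom>"
      proof -
        have "finite (insert ?E ?\<Delta>)" using good by (simp add: good_def)
        moreover have "insert ?E ?\<Delta> \<subseteq> ?T" using ex by auto
        ultimately show ?thesis by (rule con)
      qed
      then have "subst x (V ?c) A \<in> extend ?E ?\<Delta>" using sen by (simp add: extend_def)
      then have "subst x (V ?c) A \<in> ?T" using step by blast
      moreover have "finite (insert ?E ?\<Delta>)" using good by (simp add: good_def)
      then have "V ?c \<in> closed_of (snd x)"
        using witness(1,2) by (simp add: closed_of_def hasty_def)
      ultimately show ?thesis by blast
    qed
  qed
qed


section \<open>Models and completeness\<close>

fun ev :: "('m \<Rightarrow> 'm \<Rightarrow> 'm) \<Rightarrow> (con \<Rightarrow> 'm) \<Rightarrow> (var \<Rightarrow> 'm) \<Rightarrow> trm \<Rightarrow> 'm" where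
  "ev ap cn e (V x) = e x"
| "ev ap cn e (C c) = cn c"
| "ev ap cn e (s \<cdot> t) = ap (ev ap cn e s) (ev ap cn e t)"

fun sat :: "(ty \<Rightarrow> 'm set) \<Rightarrow> ('m \<Rightarrow> 'm \<Rightarrow> 'm) \<Rightarrow> (con \<Rightarrow> 'm) \<Rightarrow> (var \<Rightarrow> 'm) \<Rightarrow> fm \<Rightarrow> bool" where
  "sat D ap cn e (s \<doteq> t) \<longleftrightarrow> ev ap cn e s = ev ap cn e t"
| "sat D ap cn e \<^bold>\<bottom> \<longleftrightarrow> False"
| "sat D ap cn e (A \<^bold>\<and> B) \<longleftrightarrow> sat D ap cn e A \<and> sat D ap cn e B"
| "sat D ap cn e (A \<^bold>\<or> B) \<longleftrightarrow> sat D ap cn e A \<or> sat D ap cn e B"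
| "sat D ap cn e (A \<^bold>\<longrightarrow> B) \<longleftrightarrow> (sat D ap cn e A \<longrightarrow> sat D ap cn e B)"
| "sat D ap cn e (\<^bold>\<forall>x. A) \<longleftrightarrow> (\<forall>d\<in>D (snd x). sat D ap cn (e(x := d)) A)"
| "sat D ap cn e (\<^bold>\<exists>x. A) \<longleftrightarrow> (\<exists>d\<in>D (snd x). sat D ap cn (e(x := d)) A)"

definition env :: "(ty \<Rightarrow> 'm set) \<Rightarrow> (var \<Rightarrow> 'm) \<Rightarrow> bool" where
  "env D e \<longleftrightarrow> (\<forall>x. e x \<in> D (snd x))"

lemma env_upd [simp]: "env D e \<Longrightarrow> d \<in> D (snd x) \<Longrightarrow> env D (e(x := d))"
  by (simp add: env_def del: split_paired_All)

text \<open>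
  Induction is available for predicates defined by a formula with parameters from the model;
  these are Henkin models, whose domains at higher types need not be full.
\<close>

locale pa_model =
  fixes D :: "ty \<Rightarrow> 'm set" and ap :: "'m \<Rightarrow> 'm \<Rightarrow> 'm" and cn :: "con \<Rightarrow> 'm"
  assumes cn_D: "cn k \<in> D (cty k)"
    and ap_D: "\<lbrakk>a \<in> D (\<sigma> \<rightarrow> \<tau>); b \<in> D \<sigma>\<rbrakk> \<Longrightarrow> ap a b \<in> D \<tau>"
    and ap_K: "\<lbrakk>a \<in> D \<sigma>; b \<in> D \<tau>\<rbrakk> \<Longrightarrow> ap (ap (cn (K \<sigma> \<tau>)) a) b = a"
    and ap_S: "\<lbrakk>a \<in> D (\<rho> \<rightarrow> \<sigma> \<rightarrow> \<tau>); b \<in> D (\<rho> \<rightarrow> \<sigma>); c \<in> D \<rho>\<rbrakk>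
      \<Longrightarrow> ap (ap (ap (cn (S \<rho> \<sigma> \<tau>)) a) b) c = ap (ap a c) (ap b c)"
    and ap_R_Zero: "\<lbrakk>a \<in> D \<sigma>; b \<in> D (\<sigma> \<rightarrow> \<N> \<rightarrow> \<sigma>)\<rbrakk> \<Longrightarrow> ap (ap (ap (cn (R \<sigma>)) a) b) (cn Zero) = a"
    and ap_R_Succ: "\<lbrakk>a \<in> D \<sigma>; b \<in> D (\<sigma> \<rightarrow> \<N> \<rightarrow> \<sigma>); n \<in> D \<N>\<rbrakk>
      \<Longrightarrow> ap (ap (ap (cn (R \<sigma>)) a) b) (ap (cn Succ) n) = ap (ap b (ap (ap (ap (cn (R \<sigma>)) a) b) n)) n"
    and ap_L_Empty: "\<lbrakk>a \<in> D \<tau>; b \<in> D (\<tau> \<rightarrow> \<sigma>\<^sup>\<star> \<rightarrow> \<sigma> \<rightarrow> \<tau>)\<rbrakk>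
      \<Longrightarrow> ap (ap (ap (cn (L \<sigma> \<tau>)) a) b) (cn (Empty \<sigma>)) = a"
    and ap_L_Ext: "\<lbrakk>a \<in> D \<tau>; b \<in> D (\<tau> \<rightarrow> \<sigma>\<^sup>\<star> \<rightarrow> \<sigma> \<rightarrow> \<tau>); w \<in> D (\<sigma>\<^sup>\<star>); c \<in> D \<sigma>\<rbrakk>
      \<Longrightarrow> ap (ap (ap (cn (L \<sigma> \<tau>)) a) b) (ap (ap (cn (Ext \<sigma>)) w) c)
        = ap (ap (ap b (ap (ap (ap (cn (L \<sigma> \<tau>)) a) b) w)) w) c"
    and Succ_neq_Zero: "n \<in> D \<N> \<Longrightarrow> ap (cn Succ) n \<noteq> cn Zero"
    and Succ_inject: "\<lbrakk>m \<in> D \<N>; n \<in> D \<N>; ap (cn Succ) m = ap (cn Succ) n\<rbrakk> \<Longrightarrow> m = n"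
    and nat_induct: "\<lbrakk>wff A; bv A \<inter> Par = {}; x \<notin> Par; snd x = \<N>; env D e;
        sat D ap cn (e(x := cn Zero)) A;
        \<And>n. \<lbrakk>n \<in> D \<N>; sat D ap cn (e(x := n)) A\<rbrakk> \<Longrightarrow> sat D ap cn (e(x := ap (cn Succ) n)) A;
        n \<in> D \<N>\<rbrakk> \<Longrightarrow> sat D ap cn (e(x := n)) A"
    and seq_induct: "\<lbrakk>wff A; bv A \<inter> Par = {}; x \<notin> Par; snd x = \<sigma>\<^sup>\<star>; env D e;
        sat D ap cn (e(x := cn (Empty \<sigma>))) A;
        \<And>a c. \<lbrakk>a \<in> D (\<sigma>\<^sup>\<star>); c \<in> D \<sigma>; sat D ap cn (e(x := a)) A\<rbrakk>
          \<Longrightarrow> sat D ap cn (e(x := ap (ap (cn (Ext \<sigma>)) a) c)) A;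
        w \<in> D (\<sigma>\<^sup>\<star>)\<rbrakk> \<Longrightarrow> sat D ap cn (e(x := w)) A"

lemma closed_app: "s \<in> closed_of (\<sigma> \<rightarrow> \<tau>) \<Longrightarrow> t \<in> closed_of \<sigma> \<Longrightarrow> s \<cdot> t \<in> closed_of \<tau>"
  by (auto simp: closed_of_def hasty_def)

lemma closed_con: "cty c = \<sigma> \<Longrightarrow> C c \<in> closed_of \<sigma>"
  by (simp add: closed_of_def hasty_def)

lemma closed_hasty: "t \<in> closed_of \<sigma> \<Longrightarrow> t \<Colon> \<sigma>"
  by (simp add: closed_of_def)

lemma sentence_Eq: "s \<in> closed_of \<sigma> \<Longrightarrow> t \<in> closed_of \<sigma> \<Longrightarrow> sentence (s \<doteq> t)"
  by (auto simp: closed_of_def hasty_def sentence_def)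

context henkin_theory
begin

section \<open>Membership in a Henkin theory commutes with the logical symbols\<close>

lemma mem_derivable: "\<lbrakk>F \<turnstile> A; sentence A; finite F; F \<subseteq> T\<rbrakk> \<Longrightarrow> A \<in> T"
proof (rule ccontr)
  assume der: "F \<turnstile> A" "sentence A" "finite F" "F \<subseteq> T" and "A \<notin> T"
  then have neg: "(\<^bold>\<not> A) \<in> T" using complete by blast
  have "insert (\<^bold>\<not> A) F \<turnstile> A" by (rule pa.Weaken[OF der(1)]) auto
  moreover have "insert (\<^bold>\<not> A) F \<turnstile> \<^bold>\<not> A"
    using der(2) by (intro pa.Assume) (auto simp: sentence_def)
  ultimately have "insert (\<^bold>\<not> A) F \<turnstile> \<^bold>\<bottom>" by (rule pa.ImpE[rotated])
  then show False using consistent[of "insert (\<^bold>\<not> A) F"] neg der by auto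
qed

lemma assm: "A \<in> T \<Longrightarrow> A \<in> F \<Longrightarrow> F \<turnstile> A"
  using sentences by (intro pa.Assume) (auto simp: sentence_def)

lemma mem_Neg: "sentence A \<Longrightarrow> (\<^bold>\<not> A) \<in> T \<longleftrightarrow> A \<notin> T"
proof
  assume "sentence A" "(\<^bold>\<not> A) \<in> T"
  show "A \<notin> T"
  proof
    assume "A \<in> T"
    have "{A, \<^bold>\<not> A} \<turnstile> \<^bold>\<bottom>"
      by (rule pa.ImpE[of _ A]) (use \<open>A \<in> T\<close> \<open>(\<^bold>\<not> A) \<in> T\<close> in \<open>auto intro: assm\<close>)
    then show False using consistent[of "{A, \<^bold>\<not> A}"] \<open>A \<in> T\<close> \<open>(\<^bold>\<not> A) \<in> T\<close> by auto
  qed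
qed (use complete in blast)

lemma mem_Bot: "\<^bold>\<bottom> \<notin> T"
  using consistent[of "{\<^bold>\<bottom>}"] pa.Assume[of "\<^bold>\<bottom>" "{\<^bold>\<bottom>}"] by auto

lemma mem_And: "sentence (A \<^bold>\<and> B) \<Longrightarrow> (A \<^bold>\<and> B) \<in> T \<longleftrightarrow> A \<in> T \<and> B \<in> T"
proof -
  assume sen: "sentence (A \<^bold>\<and> B)"
  then have sA: "sentence A" and sB: "sentence B" by (auto simp: sentence_def)
  show ?thesis
  proof
    assume h: "(A \<^bold>\<and> B) \<in> T"
    then have "{A \<^bold>\<and> B} \<turnstile> A \<^bold>\<and> B" by (auto intro: assm)
    then show "A \<in> T \<and> B \<in> T"
      using mem_derivable[OF pa.AndE1 sA] mem_derivable[OF pa.AndE2 sB] h by simp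
  next
    assume h: "A \<in> T \<and> B \<in> T"
    then have "{A, B} \<turnstile> A \<^bold>\<and> B" by (intro pa.AndI assm) auto
    then show "(A \<^bold>\<and> B) \<in> T" by (rule mem_derivable) (use h sen in auto)
  qed
qed

lemma mem_Imp: "sentence (A \<^bold>\<longrightarrow> B) \<Longrightarrow> (A \<^bold>\<longrightarrow> B) \<in> T \<longleftrightarrow> (A \<in> T \<longrightarrow> B \<in> T)"
proof -
  assume sen: "sentence (A \<^bold>\<longrightarrow> B)"
  then have sA: "sentence A" and sB: "sentence B" by (auto simp: sentence_def)
  show ?thesis
  proof (intro iffI impI)
    assume h: "(A \<^bold>\<longrightarrow> B) \<in> T" "A \<in> T"
    then have "{A \<^bold>\<longrightarrow> B, A} \<turnstile> B" by (intro pa.ImpE[OF assm[OF h(1)] assm[OF h(2)]]) auto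
    then show "B \<in> T" by (rule mem_derivable) (use h sB in auto)
  next
    assume h: "A \<in> T \<longrightarrow> B \<in> T"
    show "(A \<^bold>\<longrightarrow> B) \<in> T"
    proof (cases "A \<in> T")
      case True
      then have "{B} \<turnstile> A \<^bold>\<longrightarrow> B"
        using h sA by (intro pa.ImpI assm) (auto simp: sentence_def)
      then show ?thesis by (rule mem_derivable) (use h sen True in auto)
    next
      case False
      then have n: "(\<^bold>\<not> A) \<in> T" using complete sA by blast
      have "insert A {\<^bold>\<not> A} \<turnstile> \<^bold>\<bottom>"
        by (rule pa.ImpE[of _ A]) (use sA in \<open>auto intro!: pa.Assume simp: sentence_def\<close>)
      then have "insert (\<^bold>\<not> B) (insert A {\<^bold>\<not> A}) \<turnstile> \<^bold>\<bottom>" by (rule pa.Weaken) auto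
      then have "{\<^bold>\<not> A} \<turnstile> A \<^bold>\<longrightarrow> B"
        by (rule pa.ImpI[OF pa.Classical]) (use sA sB in \<open>auto simp: sentence_def\<close>)
      then show ?thesis by (rule mem_derivable) (use n sen in auto)
    qed
  qed
qed

lemma mem_Or: "sentence (A \<^bold>\<or> B) \<Longrightarrow> (A \<^bold>\<or> B) \<in> T \<longleftrightarrow> A \<in> T \<or> B \<in> T"
proof -
  assume sen: "sentence (A \<^bold>\<or> B)"
  then have sA: "sentence A" and sB: "sentence B" by (auto simp: sentence_def)
  show ?thesis
  proof (intro iffI)
    assume h: "(A \<^bold>\<or> B) \<in> T"
    show "A \<in> T \<or> B \<in> T"
    proof (rule ccontr)
      assume "\<not> (A \<in> T \<or> B \<in> T)"
      then have n: "(\<^bold>\<not> A) \<in> T" "(\<^bold>\<not> B) \<in> T" using complete sA sB by blast+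
      let ?F = "{A \<^bold>\<or> B, \<^bold>\<not> A, \<^bold>\<not> B}"
      have "?F \<turnstile> \<^bold>\<bottom>"
      proof (rule pa.OrE)
        show "?F \<turnstile> A \<^bold>\<or> B" using h by (auto intro: assm)
        show "insert A ?F \<turnstile> \<^bold>\<bottom>"
          by (rule pa.ImpE[of _ A]) (use sA in \<open>auto intro!: pa.Assume simp: sentence_def\<close>)
        show "insert B ?F \<turnstile> \<^bold>\<bottom>"
          by (rule pa.ImpE[of _ B]) (use sB in \<open>auto intro!: pa.Assume simp: sentence_def\<close>)
      qed
      then show False using consistent[of ?F] h n by auto
    qed
  next
    assume "A \<in> T \<or> B \<in> T"
    then show "(A \<^bold>\<or> B) \<in> T"
    proof
      assume h: "A \<in> T"
      then have "{A} \<turnstile> A \<^bold>\<or> B" using sB by (intro pa.OrI1 assm) (auto simp: sentence_def)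
      then show ?thesis by (rule mem_derivable) (use h sen in auto)
    next
      assume h: "B \<in> T"
      then have "{B} \<turnstile> A \<^bold>\<or> B" using sA by (intro pa.OrI2 assm) (auto simp: sentence_def)
      then show ?thesis by (rule mem_derivable) (use h sen in auto)
    qed
  qed
qed

lemma mem_Exists:
  "sentence (\<^bold>\<exists>x. A) \<Longrightarrow> (\<^bold>\<exists>x. A) \<in> T \<longleftrightarrow> (\<exists>t\<in>closed_of (snd x). subst x t A \<in> T)"
proof
  assume sen: "sentence (\<^bold>\<exists>x. A)" and "\<exists>t\<in>closed_of (snd x). subst x t A \<in> T"
  then obtain t where t: "t \<in> closed_of (snd x)" "subst x t A \<in> T" by blast
  then have "{subst x t A} \<turnstile> \<^bold>\<exists>x. A"
    using sen by (intro pa.ExI[of _ _ t] assm free_for_disjoint)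
      (auto simp: sentence_def closed_of_def)
  then show "(\<^bold>\<exists>x. A) \<in> T" by (rule mem_derivable) (use t(2) sen in auto)
qed (rule witnessed)

text \<open>Witnesses are built in for existential sentences only, so the converse direction goes
  through duality: the negation of a universal sentence classically yields a counterexample
  sentence, whose witness contradicts one of the instances.\<close>

lemma mem_Forall:
  "sentence (\<^bold>\<forall>x. A) \<Longrightarrow> (\<^bold>\<forall>x. A) \<in> T \<longleftrightarrow> (\<forall>t\<in>closed_of (snd x). subst x t A \<in> T)"
proof (intro iffI ballI)
  fix t assume sen: "sentence (\<^bold>\<forall>x. A)" and h: "(\<^bold>\<forall>x. A) \<in> T" and t: "t \<in> closed_of (snd x)"
  have "{\<^bold>\<forall>x. A} \<turnstile> subst x t A"
    by (rule pa.AllE, rule assm[OF h])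
      (use sen t in \<open>auto simp: sentence_def closed_of_def intro: free_for_disjoint\<close>)
  moreover have "sentence (subst x t A)" using sen t by (intro sentence_subst) (auto simp: sentence_def)
  ultimately show "subst x t A \<in> T" by (rule mem_derivable) (use h in auto)
next
  assume sen: "sentence (\<^bold>\<forall>x. A)" and inst: "\<forall>t\<in>closed_of (snd x). subst x t A \<in> T"
  show "(\<^bold>\<forall>x. A) \<in> T"
  proof (rule ccontr)
    assume "(\<^bold>\<forall>x. A) \<notin> T"
    then have n: "(\<^bold>\<not> (\<^bold>\<forall>x. A)) \<in> T" using complete sen by blast
    have wA: "wff A" using sen by (simp add: sentence_def)
    let ?N = "\<^bold>\<not> (\<^bold>\<forall>x. A)" and ?E = "\<^bold>\<exists>x. \<^bold>\<not> A"
    have "{?N} \<turnstile> ?E"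
    proof (rule pa.Classical)
      let ?\<Delta> = "insert (\<^bold>\<not> ?E) {?N}"
      have "insert (\<^bold>\<not> A) ?\<Delta> \<turnstile> \<^bold>\<bottom>"
      proof (rule pa.ImpE)
        show "insert (\<^bold>\<not> A) ?\<Delta> \<turnstile> \<^bold>\<not> ?E" using wA by (intro pa.Assume) auto
        show "insert (\<^bold>\<not> A) ?\<Delta> \<turnstile> ?E"
          using wA by (intro pa.ExI[where t = "V x"])
            (auto simp: hasty_def free_for_V_same intro!: pa.Assume)
      qed
      then have "?\<Delta> \<turnstile> A" using wA by (rule pa.Classical)
      then have "?\<Delta> \<turnstile> \<^bold>\<forall>x. A" by (rule pa.AllI) auto
      moreover have "?\<Delta> \<turnstile> ?N" using wA by (intro pa.Assume) auto
      ultimately show "?\<Delta> \<turnstile> \<^bold>\<bottom>" by (rule pa.ImpE[rotated])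
    qed (use wA in simp)
    moreover have sE: "sentence ?E" using sen by (simp add: sentence_def)
    ultimately have "?E \<in> T" by (rule mem_derivable) (use n in auto)
    then obtain t where t: "t \<in> closed_of (snd x)" "(\<^bold>\<not> subst x t A) \<in> T"
      using witnessed[of x "\<^bold>\<not> A"] by auto
    moreover have "sentence (subst x t A)"
      using sen t by (intro sentence_subst) (auto simp: sentence_def)
    ultimately show False using inst mem_Neg by blast
  qed
qed

lemma mem_ax: "A \<in> pa_ax \<Longrightarrow> sentence A \<Longrightarrow> A \<in> T"
  by (rule mem_derivable[where F = "{}"]) (auto intro: pa.Ax)

section \<open>Provable equality of closed terms is a congruence\<close>

definition eqv :: "trm \<Rightarrow> trm \<Rightarrow> bool" where
  "eqv s t \<longleftrightarrow> (s \<doteq> t) \<in> T"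

text \<open>Members of \<open>T\<close> are well-formed, so the two sides of an equation in
  \<open>T\<close> have the same type, and no free variables except parameters.\<close>

lemma eqv_closed: "eqv s t \<Longrightarrow> s \<in> closed_of \<sigma> \<Longrightarrow> t \<in> closed_of \<sigma>"
  using sentences[of "s \<doteq> t"] unfolding eqv_def sentence_def closed_of_def hasty_def
  by simp

lemma eqv_refl: "t \<in> closed_of \<sigma> \<Longrightarrow> eqv t t"
  unfolding eqv_def
  by (rule mem_ax[OF pa_ax.refl]) (simp_all add: closed_of_def hasty_def sentence_def)

lemma eqv_replace:
  assumes "eqv s t" "s \<in> closed_of (snd x)" "subst x s A \<in> T"
    and "wff A" "fv A \<subseteq> insert x Par" "bv A \<inter> Par = {}"
  shows "subst x t A \<in> T"
proof -
  have t: "t \<in> closed_of (snd x)" using assms(1,2) by (rule eqv_closed)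
  have "{s \<doteq> t, subst x s A} \<turnstile> subst x t A"
    using assms t
    by (intro pa.Replace[where x = x and A = A, OF assm assm] free_for_disjoint)
      (auto simp: eqv_def closed_of_def)
  then show ?thesis
    by (rule mem_derivable) (use assms t in \<open>auto simp: eqv_def sentence_subst\<close>)
qed

lemma nonparam_notin_closed: "x \<notin> Par \<Longrightarrow> t \<in> closed_of \<sigma> \<Longrightarrow> x \<notin> tfv t"
  by (auto simp: closed_of_def)

text \<open>Replacement in a term context, which is given as a function \<open>f\<close> on terms.\<close>

lemma eqv_context:
  assumes "eqv s t" "s \<in> closed_of \<sigma>" "eqv (f s) u"
    and f: "\<And>x r. \<lbrakk>x \<notin> Par; snd x = \<sigma>\<rbrakk> \<Longrightarrow> wt (f (V x)) \<and> tyof (f (V x)) = tyof u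
      \<and> tfv (f (V x)) \<subseteq> insert x Par \<and> tsubst x r (f (V x)) = f r"
    and u: "wt u" "tfv u \<subseteq> Par"
  shows "eqv (f t) u"
proof -
  obtain x where x: "x \<notin> Par" "snd x = \<sigma>" using fresh_nonparam[of "{}" \<sigma>] by blast
  have xu: "x \<notin> tfv u" using x u by auto
  have "subst x t (f (V x) \<doteq> u) \<in> T"
    using assms(1-3) f[OF x] u xu x by (intro eqv_replace[of s t]) (auto simp: eqv_def)
  then show ?thesis using f[OF x] xu by (simp add: eqv_def)
qed

text \<open>Replacing the left occurrence of \<open>s\<close> in s = s by \<open>t\<close>, with the
  identity as context.\<close>

lemma eqv_sym: "eqv s t \<Longrightarrow> s \<in> closed_of \<sigma> \<Longrightarrow> eqv t s"
  by (rule eqv_context[of s t \<sigma> "\<lambda>r. r"]) (auto simp: eqv_refl closed_of_def hasty_def)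

lemma eqv_trans: "eqv s t \<Longrightarrow> eqv t u \<Longrightarrow> s \<in> closed_of \<sigma> \<Longrightarrow> eqv s u"
proof -
  assume h: "eqv s t" "eqv t u" and s: "s \<in> closed_of \<sigma>"
  note t = eqv_closed[OF h(1) s]
  note u = eqv_closed[OF h(2) t]
  show ?thesis
    by (rule eqv_context[of t s \<sigma> "\<lambda>r. r", OF eqv_sym[OF h(1) s] t h(2)])
      (use u t in \<open>auto simp: closed_of_def hasty_def\<close>)
qed

lemma eqv_app:
  assumes "eqv s s'" "eqv t t'" "s \<in> closed_of (\<sigma> \<rightarrow> \<tau>)" "t \<in> closed_of \<sigma>"
  shows "eqv (s \<cdot> t) (s' \<cdot> t')"
proof -
  note c' = eqv_closed[OF assms(1,3)] eqv_closed[OF assms(2,4)]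
  have cl: "s \<cdot> t \<in> closed_of \<tau>" "s' \<cdot> t \<in> closed_of \<tau>" "s' \<cdot> t' \<in> closed_of \<tau>"
    using assms c' by (auto intro: closed_app)
  have "eqv (s' \<cdot> t) (s \<cdot> t)"
    using assms cl by (intro eqv_context[of s s' "\<sigma> \<rightarrow> \<tau>" "\<lambda>r. r \<cdot> t"])
      (auto simp: nonparam_notin_closed eqv_refl[OF cl(1)] closed_of_def hasty_def)
  moreover have "eqv (s' \<cdot> t') (s' \<cdot> t)"
    using assms c' cl by (intro eqv_context[of t t' \<sigma> "\<lambda>r. s' \<cdot> r"])
      (auto simp: nonparam_notin_closed eqv_refl[OF cl(2)] closed_of_def hasty_def)
  ultimately show ?thesis using eqv_trans[OF _ _ cl(3)] eqv_sym[OF _ cl(3)] by blast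
qed

section \<open>The term model and its truth lemma\<close>

definition cls :: "trm \<Rightarrow> trm set" where
  "cls t = {s. eqv t s}"

definition dom_of :: "ty \<Rightarrow> trm set set" where
  "dom_of \<sigma> = cls ` closed_of \<sigma>"

text \<open>The carrier is untyped, so application is defined on arbitrary sets of terms through
  chosen representatives. On classes of matching types the choice does not matter, by
  congruence.\<close>

definition app :: "trm set \<Rightarrow> trm set \<Rightarrow> trm set" where
  "app F G = cls ((SOME s. s \<in> F) \<cdot> (SOME t. t \<in> G))"

definition con_of :: "con \<Rightarrow> trm set" where
  "con_of c = cls (C c)"

lemma cls_eq_iff: "s \<in> closed_of \<sigma> \<Longrightarrow> t \<in> closed_of \<tau> \<Longrightarrow> cls s = cls t \<longleftrightarrow> eqv s t"
proof
  assume s: "s \<in> closed_of \<sigma>" and t: "t \<in> closed_of \<tau>"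
  show "eqv s t" if "cls s = cls t" using that eqv_refl[OF t] by (auto simp: cls_def)
  show "cls s = cls t" if st: "eqv s t"
  proof -
    have "eqv s r \<longleftrightarrow> eqv t r" for r
      using eqv_trans[OF st _ s, of r] eqv_trans[OF eqv_sym[OF st s] _ t, of r] by blast
    then show ?thesis by (simp add: cls_def)
  qed
qed

lemma eqv_rep: "t \<in> closed_of \<sigma> \<Longrightarrow> eqv t (SOME s. s \<in> cls t)"
  using someI[of "\<lambda>s. s \<in> cls t" t] eqv_refl by (auto simp: cls_def)

lemma app_cls:
  assumes "s \<in> closed_of (\<sigma> \<rightarrow> \<tau>)" "t \<in> closed_of \<sigma>"
  shows "app (cls s) (cls t) = cls (s \<cdot> t)"
proof -
  note e = eqv_app[OF eqv_rep[OF assms(1)] eqv_rep[OF assms(2)] assms]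
  note st = closed_app[OF assms]
  show ?thesis unfolding app_def using cls_eq_iff[OF st eqv_closed[OF e st]] e by simp
qed

lemma cls_dom: "t \<in> closed_of \<sigma> \<Longrightarrow> cls t \<in> dom_of \<sigma>"
  by (simp add: dom_of_def)

lemma cls_ax: "\<lbrakk>(s \<doteq> t) \<in> pa_ax; s \<in> closed_of \<sigma>; t \<in> closed_of \<sigma>\<rbrakk> \<Longrightarrow> cls s = cls t"
  using cls_eq_iff sentence_Eq mem_ax by (simp add: eqv_def)

lemma tmsubst_closed:
  "\<lbrakk>wt t; \<And>y. e y \<in> closed_of (snd y)\<rbrakk> \<Longrightarrow> tmsubst e t \<in> closed_of (tyof t)"
  using wt_tmsubst[of e t] by (auto simp: closed_of_def tfv_tmsubst hasty_def)

lemma ev_cls: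
  "\<lbrakk>wt t; \<And>y. e y \<in> closed_of (snd y)\<rbrakk>
    \<Longrightarrow> ev app con_of (\<lambda>y. cls (e y)) t = cls (tmsubst e t)"
proof (induction t)
  case (App s t)
  then have "tyof s = tyof t \<rightarrow> tyof (s \<cdot> t)" by simp
  then have "app (cls (tmsubst e s)) (cls (tmsubst e t)) = cls (tmsubst e s \<cdot> tmsubst e t)"
    using tmsubst_closed[of s e] tmsubst_closed[of t e] App.prems
    by (intro app_cls[of _ "tyof t" "tyof (s \<cdot> t)"]) (simp_all del: tyof.simps)
  then show ?case using App by simp
qed (auto simp: con_of_def)

lemma sentence_msubst:
  "\<lbrakk>wff A; bv A \<inter> Par = {}; \<And>y. e y \<in> closed_of (snd y)\<rbrakk> \<Longrightarrow> sentence (msubst e A)"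
  using fv_msubst[of e A] wff_msubst[of e A, OF closed_hasty]
  by (fastforce simp: sentence_def closed_of_def)

lemma sentence_quantified:
  assumes "wff A" "bv A \<inter> Par = {}" "\<And>y. e y \<in> closed_of (snd y)" "x \<notin> Par"
  shows "sentence (\<^bold>\<forall>x. msubst (e(x := V x)) A)" "sentence (\<^bold>\<exists>x. msubst (e(x := V x)) A)"
proof -
  have "tfv (if y = x then V x else e y) \<subseteq> insert x Par" for y
    using assms(3)[of y] by (auto simp: closed_of_def)
  then have "(\<Union>y\<in>fv A. tfv ((e(x := V x)) y)) \<subseteq> insert x Par"
    unfolding fun_upd_apply by blast
  with fv_msubst have "fv (msubst (e(x := V x)) A) \<subseteq> insert x Par" by (rule subset_trans)
  moreover have "(e(x := V x)) y \<Colon> snd y" for y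
    using closed_hasty[OF assms(3)] by (simp add: hasty_def)
  then have "wff (msubst (e(x := V x)) A)" using assms(1) wff_msubst by blast
  ultimately show "sentence (\<^bold>\<forall>x. msubst (e(x := V x)) A)" "sentence (\<^bold>\<exists>x. msubst (e(x := V x)) A)"
    using assms by (auto simp: sentence_def)
qed

lemma subst_msubst_closed:
  "\<lbrakk>\<And>y. e y \<in> closed_of (snd y); x \<notin> Par\<rbrakk>
    \<Longrightarrow> subst x t (msubst (e(x := V x)) A) = msubst (e(x := t)) A"
proof -
  assume h: "\<And>y. e y \<in> closed_of (snd y)" "x \<notin> Par"
  have "x \<notin> tfv ((e(x := V x)) y)" if "y \<noteq> x" for y
    using that nonparam_notin_closed[OF h(2) h(1)[of y]] by simp
  then have "subst x t (msubst (e(x := V x)) A) = msubst ((e(x := V x))(x := t)) A"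
    by (intro subst_msubst) simp
  then show ?thesis by (simp only: fun_upd_upd)
qed

lemma ball_dom: "(\<forall>d\<in>dom_of \<sigma>. P d) \<longleftrightarrow> (\<forall>t\<in>closed_of \<sigma>. P (cls t))"
  by (simp add: dom_of_def)

lemma bex_dom: "(\<exists>d\<in>dom_of \<sigma>. P d) \<longleftrightarrow> (\<exists>t\<in>closed_of \<sigma>. P (cls t))"
  by (simp add: dom_of_def)

text \<open>Environments are given by closed terms, so truth at the classes is compared with
  membership of the closed instance. The induction generalises over \<open>e\<close>: below a
  quantifier, instantiating the open variable with \<open>t\<close> is the same as updating
  \<open>e\<close> by \<open>t\<close>, and the elements of the domain are precisely the classes of
  such \<open>t\<close>.\<close>

lemma truth:
  "\<lbrakk>wff A; bv A \<inter> Par = {}; \<And>y. e y \<in> closed_of (snd y)\<rbrakk>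
    \<Longrightarrow> sat dom_of app con_of (\<lambda>y. cls (e y)) A \<longleftrightarrow> msubst e A \<in> T"
proof (induction A arbitrary: e)
  case (Eq s t)
  then show ?case
    using ev_cls[of s e] ev_cls[of t e] tmsubst_closed[of s e] tmsubst_closed[of t e]
    by (simp add: cls_eq_iff eqv_def)
next
  case (And A B)
  then show ?case using sentence_msubst[of "A \<^bold>\<and> B" e]
    by (auto simp: mem_And Int_Un_distrib2)
next
  case (Or A B)
  then show ?case using sentence_msubst[of "A \<^bold>\<or> B" e]
    by (auto simp: mem_Or Int_Un_distrib2)
next
  case (Imp A B)
  then show ?case using sentence_msubst[of "A \<^bold>\<longrightarrow> B" e]
    by (auto simp: mem_Imp Int_Un_distrib2)
next
  case (Forall x A)
  have upd: "(\<lambda>y. cls (e y))(x := cls t) = (\<lambda>y. cls ((e(x := t)) y))" for t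
    unfolding fun_upd_def by (rule ext) simp
  have "sat dom_of app con_of ((\<lambda>y. cls (e y))(x := cls t)) A \<longleftrightarrow> msubst (e(x := t)) A \<in> T"
    if "t \<in> closed_of (snd x)" for t
    unfolding upd using Forall.prems that by (intro Forall.IH) auto
  then show ?case
    using Forall.prems sentence_quantified(1)[of A e x]
    by (simp add: mem_Forall subst_msubst_closed ball_dom del: fun_upd_apply)
next
  case (Exists x A)
  have upd: "(\<lambda>y. cls (e y))(x := cls t) = (\<lambda>y. cls ((e(x := t)) y))" for t
    unfolding fun_upd_def by (rule ext) simp
  have "sat dom_of app con_of ((\<lambda>y. cls (e y))(x := cls t)) A \<longleftrightarrow> msubst (e(x := t)) A \<in> T"
    if "t \<in> closed_of (snd x)" for t
    unfolding upd using Exists.prems that by (intro Exists.IH) auto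
  then show ?case
    using Exists.prems sentence_quantified(2)[of A e x]
    by (simp add: mem_Exists subst_msubst_closed bex_dom del: fun_upd_apply)
qed (simp add: mem_Bot)

section \<open>Induction in the term model\<close>

lemma env_closed: "env dom_of e \<Longrightarrow> \<exists>e'. (\<forall>y. e' y \<in> closed_of (snd y)) \<and> e = (\<lambda>y. cls (e' y))"
proof -
  assume "env dom_of e"
  then have "\<forall>y. \<exists>t. t \<in> closed_of (snd y) \<and> e y = cls t" unfolding env_def dom_of_def by blast
  then obtain e' where "\<And>y. e' y \<in> closed_of (snd y) \<and> e y = cls (e' y)" by metis
  then show ?thesis by (intro exI[of _ e']) auto
qed

text \<open>All elements of the term model are named by closed terms, so the semantic premises say
  that each closed instance of the induction step belongs to \<open>T\<close>. Hence so does the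
  universally quantified step, and the induction rule of the calculus applies to a finite subset of
  \<open>T\<close>.\<close>

lemma model_nat_induct:
  assumes A: "wff A" "bv A \<inter> Par = {}" "x \<notin> Par" "snd x = \<N>" and "env dom_of e"
    and base: "sat dom_of app con_of (e(x := con_of Zero)) A"
    and step: "\<And>n. \<lbrakk>n \<in> dom_of \<N>; sat dom_of app con_of (e(x := n)) A\<rbrakk>
      \<Longrightarrow> sat dom_of app con_of (e(x := app (con_of Succ) n)) A"
    and n: "n \<in> dom_of \<N>"
  shows "sat dom_of app con_of (e(x := n)) A"
proof -
  obtain e' where e': "\<And>y. e' y \<in> closed_of (snd y)" and e: "e = (\<lambda>y. cls (e' y))"
    using env_closed[OF \<open>env dom_of e\<close>] by blast
  have upd: "e(x := cls t) = (\<lambda>y. cls ((e'(x := t)) y))" for t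
    unfolding e fun_upd_def by (rule ext) simp
  \<comment> \<open>The parameters from the model become closed terms inside the formula; only the
    induction variable stays open.\<close>
  define A' where "A' = msubst (e'(x := V x)) A"
  have inst: "subst x t A' \<in> T \<longleftrightarrow> sat dom_of app con_of (e(x := cls t)) A"
    if "t \<in> closed_of \<N>" for t
  proof -
    have "(e'(x := t)) y \<in> closed_of (snd y)" for y using e' that A(4) by simp
    then show ?thesis
      unfolding A'_def upd subst_msubst_closed[OF e' A(3)] using truth A(1,2) by blast
  qed
  have quant: "sentence (\<^bold>\<forall>x. A')"
    unfolding A'_def using A e' by (intro sentence_quantified) auto
  let ?step = "\<^bold>\<forall>x. A' \<^bold>\<longrightarrow> subst x (C Succ \<cdot> V x) A'"
  have ty: "C Succ \<cdot> V x \<Colon> snd x" using A by (simp add: hasty_def)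
  have sen: "sentence ?step"
    using quant ty fv_subst[of x "C Succ \<cdot> V x" A'] by (auto simp: sentence_def wff_subst)
  have 0: "C Zero \<in> closed_of \<N>" by (simp add: closed_con)
  have zero: "subst x (C Zero) A' \<in> T" using base inst[OF 0] by (simp add: con_of_def)
  have suc: "?step \<in> T"
    unfolding mem_Forall[OF sen]
  proof
    fix t assume "t \<in> closed_of (snd x)"
    then have t: "t \<in> closed_of \<N>" "C Succ \<cdot> t \<in> closed_of \<N>"
      using A closed_app[of "C Succ" \<N> \<N>] by (auto simp: closed_con)
    have "cls (C Succ \<cdot> t) = app (con_of Succ) (cls t)"
      using t(1) app_cls[of "C Succ" \<N> \<N> t] by (simp add: con_of_def closed_con)
    then have "subst x t A' \<in> T \<longrightarrow> subst x (C Succ \<cdot> t) A' \<in> T"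
      using step[of "cls t"] inst t cls_dom by simp
    moreover have "sentence (subst x t (A' \<^bold>\<longrightarrow> subst x (C Succ \<cdot> V x) A'))"
      using sen t A by (intro sentence_subst) (auto simp: sentence_def)
    ultimately show "subst x t (A' \<^bold>\<longrightarrow> subst x (C Succ \<cdot> V x) A') \<in> T"
      by (simp add: mem_Imp subst_subst_same)
  qed
  have "{subst x (C Zero) A', ?step} \<turnstile> \<^bold>\<forall>x. A'"
    by (rule pa.Induct) (use A(4) zero suc in \<open>auto intro: assm\<close>)
  then have "(\<^bold>\<forall>x. A') \<in> T" by (rule mem_derivable) (use quant zero suc in auto)
  then show ?thesis using mem_Forall[OF quant] inst n A(4) by (auto simp: dom_of_def)
qed

lemma model_seq_induct:
  assumes A: "wff A" "bv A \<inter> Par = {}" "x \<notin> Par" "snd x = \<sigma>\<^sup>\<star>" and "env dom_of e"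
    and base: "sat dom_of app con_of (e(x := con_of (Empty \<sigma>))) A"
    and step: "\<And>a c. \<lbrakk>a \<in> dom_of (\<sigma>\<^sup>\<star>); c \<in> dom_of \<sigma>; sat dom_of app con_of (e(x := a)) A\<rbrakk>
      \<Longrightarrow> sat dom_of app con_of (e(x := app (app (con_of (Ext \<sigma>)) a) c)) A"
    and w: "w \<in> dom_of (\<sigma>\<^sup>\<star>)"
  shows "sat dom_of app con_of (e(x := w)) A"
proof -
  obtain e' where e': "\<And>y. e' y \<in> closed_of (snd y)" and e: "e = (\<lambda>y. cls (e' y))"
    using env_closed[OF \<open>env dom_of e\<close>] by blast
  have upd: "e(x := cls t) = (\<lambda>y. cls ((e'(x := t)) y))" for t
    unfolding e fun_upd_def by (rule ext) simp
  define A' where "A' = msubst (e'(x := V x)) A"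
  have inst: "subst x t A' \<in> T \<longleftrightarrow> sat dom_of app con_of (e(x := cls t)) A"
    if "t \<in> closed_of (\<sigma>\<^sup>\<star>)" for t
  proof -
    have "(e'(x := t)) y \<in> closed_of (snd y)" for y using e' that A(4) by simp
    then show ?thesis
      unfolding A'_def upd subst_msubst_closed[OF e' A(3)] using truth A(1,2) by blast
  qed
  have quant: "sentence (\<^bold>\<forall>x. A')"
    unfolding A'_def using A e' by (intro sentence_quantified) auto
  have "finite (insert x (fv A' \<union> bv A'))" by simp
  \<comment> \<open>The sequence rule has a second variable, for the appended element. It must be
    new for the formula, and outside \<open>Par\<close> because it gets bound in a sentence.\<close>
  from fresh_nonparam[OF this, of \<sigma>] obtain y
    where y: "y \<notin> Par" "snd y = \<sigma>" "y \<notin> fv A'" "y \<notin> bv A'" "y \<noteq> x" by auto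
  let ?ext = "C (Ext \<sigma>) \<cdot> V x \<cdot> V y"
  let ?body = "A' \<^bold>\<longrightarrow> subst x ?ext A'"
  let ?step = "\<^bold>\<forall>x. \<^bold>\<forall>y. ?body"
  have ty: "?ext \<Colon> snd x" using A y by (simp add: hasty_def)
  have sen: "sentence ?step"
    using quant ty y fv_subst[of x ?ext A'] by (auto simp: sentence_def wff_subst)
  have 0: "C (Empty \<sigma>) \<in> closed_of (\<sigma>\<^sup>\<star>)" by (simp add: closed_con)
  have empty: "subst x (C (Empty \<sigma>)) A' \<in> T" using base inst[OF 0] by (simp add: con_of_def)
  have suc: "?step \<in> T"
    unfolding mem_Forall[OF sen]
  proof
    fix t assume t: "t \<in> closed_of (snd x)"
    have yt: "y \<notin> tfv t" using t y by (auto simp: closed_of_def)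
    have sen': "sentence (subst x t (\<^bold>\<forall>y. ?body))"
      using sen t by (intro sentence_subst) (auto simp: sentence_def)
    then have sen'': "sentence (\<^bold>\<forall>y. subst x t ?body)" using y by simp
    have "(\<^bold>\<forall>y. subst x t ?body) \<in> T"
      unfolding mem_Forall[OF sen'']
    proof
      fix u assume u: "u \<in> closed_of (snd y)"
      have cl: "t \<in> closed_of (\<sigma>\<^sup>\<star>)" "u \<in> closed_of \<sigma>" using A y t u by auto
      have E: "C (Ext \<sigma>) \<in> closed_of (\<sigma>\<^sup>\<star> \<rightarrow> \<sigma> \<rightarrow> \<sigma>\<^sup>\<star>)" by (simp add: closed_con)
      note E1 = closed_app[OF E cl(1)] note E2 = closed_app[OF E1 cl(2)]
      have "cls (C (Ext \<sigma>) \<cdot> t \<cdot> u) = app (app (con_of (Ext \<sigma>)) (cls t)) (cls u)"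
        using app_cls[OF E cl(1)] app_cls[OF E1 cl(2)] by (simp add: con_of_def)
      then have "subst x t A' \<in> T \<longrightarrow> subst x (C (Ext \<sigma>) \<cdot> t \<cdot> u) A' \<in> T"
        using step[of "cls t" "cls u"] inst cl E2 cls_dom by simp
      moreover have "y \<notin> fv (subst x t A')" using fv_subst[of x t A'] y yt by auto
      then have eq: "subst y u (subst x t ?body)
          = (subst x t A' \<^bold>\<longrightarrow> subst x (C (Ext \<sigma>) \<cdot> t \<cdot> u) A')"
        using y yt by (simp add: subst_subst_same subst_subst_other)
      moreover have "sentence (subst y u (subst x t ?body))"
        using sen'' u by (intro sentence_subst) (auto simp: sentence_def)
      ultimately show "subst y u (subst x t ?body) \<in> T" by (simp add: mem_Imp)
    qed
    then show "subst x t (\<^bold>\<forall>y. ?body) \<in> T" using y by simp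
  qed
  have "{subst x (C (Empty \<sigma>)) A', ?step} \<turnstile> \<^bold>\<forall>x. A'"
    by (rule pa.Seq_Induct[where \<sigma> = \<sigma> and y = y])
      (use A y quant empty suc in \<open>auto intro!: assm free_for_disjoint simp: sentence_def\<close>)
  then have "(\<^bold>\<forall>x. A') \<in> T" by (rule mem_derivable) (use quant empty suc in auto)
  then show ?thesis using mem_Forall[OF quant] inst w A(4) by (auto simp: dom_of_def)
qed

text \<open>Pairs an element with a typed closed term that names it. Composing such pairs along
  applications names both sides of a model equation, after which \<open>reps_ax\<close> carries over
  the corresponding axiom.\<close>

definition reps :: "trm set \<Rightarrow> trm \<Rightarrow> ty \<Rightarrow> bool" where
  "reps F t \<sigma> \<longleftrightarrow> F = cls t \<and> t \<in> closed_of \<sigma>"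

lemma reps_app: "reps F s (\<sigma> \<rightarrow> \<tau>) \<Longrightarrow> reps G t \<sigma> \<Longrightarrow> reps (app F G) (s \<cdot> t) \<tau>"
  by (auto simp: reps_def app_cls closed_app)

lemma reps_con: "reps (con_of c) (C c) (cty c)"
  by (simp add: reps_def con_of_def closed_con)

lemma reps_dom: "F \<in> dom_of \<sigma> \<Longrightarrow> \<exists>t. reps F t \<sigma>"
  by (auto simp: reps_def dom_of_def)

lemma reps_hasty: "reps F t \<sigma> \<Longrightarrow> t \<Colon> \<sigma>"
  by (simp add: reps_def closed_of_def)

lemma reps_ax: "\<lbrakk>reps F s \<sigma>; reps G t \<sigma>; (s \<doteq> t) \<in> pa_ax\<rbrakk> \<Longrightarrow> F = G"
  using cls_ax by (auto simp: reps_def)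

lemma model: "pa_model dom_of app con_of"
proof
  show "con_of c \<in> dom_of (cty c)" for c
    using reps_con[of c] by (auto simp: reps_def dom_of_def)
  show "app a b \<in> dom_of \<tau>" if h: "a \<in> dom_of (\<sigma> \<rightarrow> \<tau>)" "b \<in> dom_of \<sigma>" for a b \<sigma> \<tau>
    using h by (auto simp: dom_of_def app_cls closed_app)
  show "app (app (con_of (K \<sigma> \<tau>)) a) b = a" if h: "a \<in> dom_of \<sigma>" "b \<in> dom_of \<tau>" for a b \<sigma> \<tau>
  proof -
    obtain s t where r: "reps a s \<sigma>" "reps b t \<tau>" using h[THEN reps_dom] by blast
    show ?thesis
      by (rule reps_ax[OF reps_app[OF reps_app[OF reps_con[of "K \<sigma> \<tau>", simplified] r(1)] r(2)] r(1)
            pa_ax.K[OF r[THEN reps_hasty]]])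
  qed
  show "app (app (app (con_of (S \<rho> \<sigma> \<tau>)) a) b) c = app (app a c) (app b c)"
    if h: "a \<in> dom_of (\<rho> \<rightarrow> \<sigma> \<rightarrow> \<tau>)" "b \<in> dom_of (\<rho> \<rightarrow> \<sigma>)" "c \<in> dom_of \<rho>" for a b c \<rho> \<sigma> \<tau>
  proof -
    obtain s t u where r: "reps a s (\<rho> \<rightarrow> \<sigma> \<rightarrow> \<tau>)" "reps b t (\<rho> \<rightarrow> \<sigma>)" "reps c u \<rho>"
      using h[THEN reps_dom] by blast
    note S = reps_con[of "S \<rho> \<sigma> \<tau>", simplified]
    show ?thesis
      by (rule reps_ax[OF reps_app[OF reps_app[OF reps_app[OF S r(1)] r(2)] r(3)]
            reps_app[OF reps_app[OF r(1,3)] reps_app[OF r(2,3)]] pa_ax.S[OF r[THEN reps_hasty]]])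
  qed
  fix \<sigma> \<tau>
  show "app (app (app (con_of (R \<sigma>)) a) b) (con_of Zero) = a"
    if h: "a \<in> dom_of \<sigma>" "b \<in> dom_of (\<sigma> \<rightarrow> \<N> \<rightarrow> \<sigma>)" for a b
  proof -
    obtain s t where r: "reps a s \<sigma>" "reps b t (\<sigma> \<rightarrow> \<N> \<rightarrow> \<sigma>)" using h[THEN reps_dom] by blast
    note R = reps_con[of "R \<sigma>", simplified] and Z = reps_con[of Zero, simplified]
    show ?thesis
      by (rule reps_ax[OF reps_app[OF reps_app[OF reps_app[OF R r(1)] r(2)] Z] r(1) pa_ax.R0[OF r[THEN reps_hasty]]])
  qed
  show "app (app (app (con_of (R \<sigma>)) a) b) (app (con_of Succ) n)
      = app (app b (app (app (app (con_of (R \<sigma>)) a) b) n)) n"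
    if h: "a \<in> dom_of \<sigma>" "b \<in> dom_of (\<sigma> \<rightarrow> \<N> \<rightarrow> \<sigma>)" "n \<in> dom_of \<N>" for a b n
  proof -
    obtain s t u where r: "reps a s \<sigma>" "reps b t (\<sigma> \<rightarrow> \<N> \<rightarrow> \<sigma>)" "reps n u \<N>"
      using h[THEN reps_dom] by blast
    note R = reps_con[of "R \<sigma>", simplified] and Su = reps_con[of Succ, simplified]
    note Rab = reps_app[OF reps_app[OF R r(1)] r(2)]
    show ?thesis
      by (rule reps_ax[OF reps_app[OF Rab reps_app[OF Su r(3)]]
            reps_app[OF reps_app[OF r(2) reps_app[OF Rab r(3)]] r(3)] pa_ax.RS[OF r[THEN reps_hasty]]])
  qed
  show "app (app (app (con_of (L \<sigma> \<tau>)) a) b) (con_of (Empty \<sigma>)) = a"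
    if h: "a \<in> dom_of \<tau>" "b \<in> dom_of (\<tau> \<rightarrow> \<sigma>\<^sup>\<star> \<rightarrow> \<sigma> \<rightarrow> \<tau>)" for a b
  proof -
    obtain s t where r: "reps a s \<tau>" "reps b t (\<tau> \<rightarrow> \<sigma>\<^sup>\<star> \<rightarrow> \<sigma> \<rightarrow> \<tau>)" using h[THEN reps_dom] by blast
    note L = reps_con[of "L \<sigma> \<tau>", simplified] and E = reps_con[of "Empty \<sigma>", simplified]
    show ?thesis
      by (rule reps_ax[OF reps_app[OF reps_app[OF reps_app[OF L r(1)] r(2)] E] r(1) pa_ax.L0[OF r[THEN reps_hasty]]])
  qed
  show "app (app (app (con_of (L \<sigma> \<tau>)) a) b) (app (app (con_of (Ext \<sigma>)) w) c)
      = app (app (app b (app (app (app (con_of (L \<sigma> \<tau>)) a) b) w)) w) c"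
    if h: "a \<in> dom_of \<tau>" "b \<in> dom_of (\<tau> \<rightarrow> \<sigma>\<^sup>\<star> \<rightarrow> \<sigma> \<rightarrow> \<tau>)" "w \<in> dom_of (\<sigma>\<^sup>\<star>)" "c \<in> dom_of \<sigma>"
    for a b w c
  proof -
    obtain s t u v where r: "reps a s \<tau>" "reps b t (\<tau> \<rightarrow> \<sigma>\<^sup>\<star> \<rightarrow> \<sigma> \<rightarrow> \<tau>)"
      "reps w u (\<sigma>\<^sup>\<star>)" "reps c v \<sigma>"
      using h[THEN reps_dom] by blast
    note L = reps_con[of "L \<sigma> \<tau>", simplified] and E = reps_con[of "Ext \<sigma>", simplified]
    note Lab = reps_app[OF reps_app[OF L r(1)] r(2)]
    show ?thesis
      by (rule reps_ax[OF reps_app[OF Lab reps_app[OF reps_app[OF E r(3)] r(4)]]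
            reps_app[OF reps_app[OF reps_app[OF r(2) reps_app[OF Lab r(3)]] r(3)] r(4)] pa_ax.LE[OF r[THEN reps_hasty]]])
  qed
  note Su = reps_con[of Succ, simplified] and Z = reps_con[of Zero, simplified]
  show "app (con_of Succ) n \<noteq> con_of Zero" if h: "n \<in> dom_of \<N>" for n
  proof
    assume eq: "app (con_of Succ) n = con_of Zero"
    obtain t where t: "reps n t \<N>" using h[THEN reps_dom] by blast
    from reps_app[OF Su t] Z have c: "C Succ \<cdot> t \<in> closed_of \<N>" "C Zero \<in> closed_of \<N>"
      and "cls (C Succ \<cdot> t) = cls (C Zero)"
      using eq by (auto simp: reps_def)
    then have "eqv (C Succ \<cdot> t) (C Zero)" using cls_eq_iff[OF c] by blast
    moreover have "(\<^bold>\<not> (C Succ \<cdot> t \<doteq> C Zero)) \<in> T"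
      using sentence_Eq[OF c] by (intro mem_ax pa_ax.Succ_Zero reps_hasty[OF t])
        (auto simp: sentence_def)
    ultimately show False using mem_Neg[OF sentence_Eq[OF c]] by (simp add: eqv_def)
  qed
  show "m = n" if h: "m \<in> dom_of \<N>" "n \<in> dom_of \<N>" "app (con_of Succ) m = app (con_of Succ) n" for m n
  proof -
    obtain s t where r: "reps m s \<N>" "reps n t \<N>" using h(1,2)[THEN reps_dom] by blast
    then have st: "s \<in> closed_of \<N>" "t \<in> closed_of \<N>" by (auto simp: reps_def)
    from reps_app[OF Su r(1)] reps_app[OF Su r(2)]
    have c: "C Succ \<cdot> s \<in> closed_of \<N>" "C Succ \<cdot> t \<in> closed_of \<N>"
      and "cls (C Succ \<cdot> s) = cls (C Succ \<cdot> t)"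
      using h(3) by (auto simp: reps_def)
    then have "eqv (C Succ \<cdot> s) (C Succ \<cdot> t)" using cls_eq_iff[OF c] by blast
    moreover have sen: "sentence (C Succ \<cdot> s \<doteq> C Succ \<cdot> t \<^bold>\<longrightarrow> s \<doteq> t)"
      using sentence_Eq[OF c] sentence_Eq[OF st] by (auto simp: sentence_def)
    then have "(C Succ \<cdot> s \<doteq> C Succ \<cdot> t \<^bold>\<longrightarrow> s \<doteq> t) \<in> T"
      by (intro mem_ax pa_ax.Succ_inj reps_hasty[OF r(1)] reps_hasty[OF r(2)])
    ultimately have "eqv s t" using mem_Imp[OF sen] by (simp add: eqv_def)
    then show ?thesis using r cls_eq_iff[OF st] by (simp add: reps_def)
  qed
qed (fact model_nat_induct model_seq_induct)+

end

text \<open>Validity is demanded only over the carrier \<open>trm set\<close>: a hypothesis cannot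
  range over types, and this is the carrier of the countermodel built from a maximal consistent
  theory containing the negation.\<close>

theorem completeness:
  assumes sen: "sentence A"
    and valid: "\<And>(D :: ty \<Rightarrow> trm set set) ap cn e. pa_model D ap cn \<Longrightarrow> env D e \<Longrightarrow> sat D ap cn e A"
  shows "{} \<turnstile> A"
proof (rule ccontr)
  assume "\<not> {} \<turnstile> A"
  then have "\<not> {\<^bold>\<not> A} \<turnstile> \<^bold>\<bottom>" using pa.Classical[of A "{}"] sen by (auto simp: sentence_def)
  then have "good {\<^bold>\<not> A}" using sen by (simp add: good_def sentence_def)
  from henkin_extension[OF this] obtain T where "henkin_theory T" and neg: "(\<^bold>\<not> A) \<in> T" by auto
  interpret henkin_theory T by fact
  obtain c where c: "\<And>\<sigma>. c \<sigma> \<in> Par \<and> snd (c \<sigma>) = \<sigma>"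
    using fresh_param[OF finite.emptyI] by metis
  \<comment> \<open>Parameters denote themselves, so the substitution leaves the sentence
    \<open>A\<close> unchanged. Other variables only need some closed term of the right
    type.\<close>
  define e where "e y = V (if y \<in> Par then y else c (snd y))" for y
  have e: "e y \<in> closed_of (snd y)" for y
    using c by (simp add: e_def closed_of_def hasty_def)
  have "env dom_of (\<lambda>y. cls (e y))" unfolding env_def using e cls_dom by blast
  with valid[OF model] have "sat dom_of app con_of (\<lambda>y. cls (e y)) A" .
  then have "msubst e A \<in> T" using truth[of A e] sen e by (simp add: sentence_def)
  moreover have "msubst e A = A"
    using sen by (intro msubst_ident) (auto simp: e_def sentence_def)
  ultimately show False using neg mem_Neg[OF sen] by simp
qed


section \<open>Terms and formulas in a model\<close>

declare lam.simps [simp del]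

section \<open>Typing and evaluation of the defined terms\<close>

lemma lam_type: "wt t \<Longrightarrow> wt (lam x t) \<and> tyof (lam x t) = snd x \<rightarrow> tyof t"
  by (induction t) (auto simp: lam.simps)

lemma wt_lam [simp]: "wt t \<Longrightarrow> wt (lam x t)"
  and tyof_lam [simp]: "wt t \<Longrightarrow> tyof (lam x t) = snd x \<rightarrow> tyof t"
  by (simp_all add: lam_type)

lemma tfv_lam [simp]: "tfv (lam x t) = tfv t - {x}"
  by (induction t) (auto simp: lam.simps)

lemma zero_t_type [simp]: "wt (zero_t \<sigma>)" "tyof (zero_t \<sigma>) = \<sigma>" "tfv (zero_t \<sigma>) = {}"
proof -
  have "wt (zero_t \<sigma>) \<and> tyof (zero_t \<sigma>) = \<sigma> \<and> tfv (zero_t \<sigma>) = {}"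
    by (induction \<sigma>) auto
  then show "wt (zero_t \<sigma>)" "tyof (zero_t \<sigma>) = \<sigma>" "tfv (zero_t \<sigma>) = {}" by auto
qed

text \<open>The recursor step ignores the recursive value and returns the shortened word. Together
  with \<open>last_t\<close> this inverts \<open>Ext\<close>, which makes \<open>Ext\<close>
  injective.\<close>

definition butlast_t :: "ty \<Rightarrow> trm" where
  "butlast_t \<sigma> = (let r = (''r'', \<sigma>\<^sup>\<star>); a = (''a'', \<sigma>\<^sup>\<star>); x = (''x'', \<sigma>) in
     C (L \<sigma> \<sigma>\<^sup>\<star>) \<cdot> C (Empty \<sigma>) \<cdot> (\<^bold>\<lambda>r. \<^bold>\<lambda>a. \<^bold>\<lambda>x. V a))"

definition last_t :: "ty \<Rightarrow> trm" where
  "last_t \<sigma> = (let r = (''r'', \<sigma>); a = (''a'', \<sigma>\<^sup>\<star>); x = (''x'', \<sigma>) in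
     C (L \<sigma> \<sigma>) \<cdot> zero_t \<sigma> \<cdot> (\<^bold>\<lambda>r. \<^bold>\<lambda>a. \<^bold>\<lambda>x. V x))"

lemma pred_t_type [simp]: "wt pred_t" "tyof pred_t = \<N> \<rightarrow> \<N>" "tfv pred_t = {}"
  by (auto simp: pred_t_def Let_def)

lemma monus_t_type [simp]: "wt monus_t" "tyof monus_t = \<N> \<rightarrow> \<N> \<rightarrow> \<N>" "tfv monus_t = {}"
  by (auto simp: monus_t_def Let_def)

lemma len_t_type [simp]: "wt (len_t \<sigma>)" "tyof (len_t \<sigma>) = \<sigma>\<^sup>\<star> \<rightarrow> \<N>" "tfv (len_t \<sigma>) = {}"
  by (auto simp: len_t_def Let_def)

lemma append_t_type [simp]:
  "wt (append_t \<sigma>)" "tyof (append_t \<sigma>) = \<sigma>\<^sup>\<star> \<rightarrow> \<sigma>\<^sup>\<star> \<rightarrow> \<sigma>\<^sup>\<star>" "tfv (append_t \<sigma>) = {}"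
  by (auto simp: append_t_def Let_def)

lemma nth_t_type [simp]:
  "wt (nth_t \<sigma>)" "tyof (nth_t \<sigma>) = \<sigma>\<^sup>\<star> \<rightarrow> \<N> \<rightarrow> \<sigma>" "tfv (nth_t \<sigma>) = {}"
  by (auto simp: nth_t_def Let_def)

lemma init_t_type [simp]:
  "wt (init_t \<sigma>)" "tyof (init_t \<sigma>) = \<sigma>\<^sup>\<omega> \<rightarrow> \<N> \<rightarrow> \<sigma>\<^sup>\<star>" "tfv (init_t \<sigma>) = {}"
  by (auto simp: init_t_def Let_def)

lemma butlast_t_type [simp]:
  "wt (butlast_t \<sigma>)" "tyof (butlast_t \<sigma>) = \<sigma>\<^sup>\<star> \<rightarrow> \<sigma>\<^sup>\<star>" "tfv (butlast_t \<sigma>) = {}"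
  by (auto simp: butlast_t_def Let_def)

lemma last_t_type [simp]:
  "wt (last_t \<sigma>)" "tyof (last_t \<sigma>) = \<sigma>\<^sup>\<star> \<rightarrow> \<sigma>" "tfv (last_t \<sigma>) = {}"
  by (auto simp: last_t_def Let_def)

lemma wff_le [simp]: "wff (s \<preceq> t) \<longleftrightarrow> wt s \<and> wt t \<and> tyof s = \<N> \<and> tyof t = \<N>"
  by (auto simp: le_fm_def)

lemma wff_less [simp]: "wff (s \<prec> t) \<longleftrightarrow> wt s \<and> wt t \<and> tyof s = \<N> \<and> tyof t = \<N>"
  by (auto simp: less_fm_def)

lemma bv_le [simp]: "bv (s \<preceq> t) = {}" "bv (s \<prec> t) = {}"
  by (simp_all add: le_fm_def less_fm_def)

lemma ev_cong: "(\<And>x. x \<in> tfv t \<Longrightarrow> e x = e' x) \<Longrightarrow> ev ap cn e t = ev ap cn e' t"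
  by (induction t) auto

lemma ev_upd_fresh: "x \<notin> tfv t \<Longrightarrow> ev ap cn (e(x := d)) t = ev ap cn e t"
  by (rule ev_cong) auto

lemma env_in: "env D e \<Longrightarrow> e x \<in> D (snd x)"
  unfolding env_def by blast

context pa_model
begin

notation ap (infixl "\<bullet>" 90)

lemma ev_D: "wt t \<Longrightarrow> env D e \<Longrightarrow> ev ap cn e t \<in> D (tyof t)"
proof (induction t)
  case (App s t)
  then have "tyof s = tyof t \<rightarrow> tyof (s \<cdot> t)" by simp
  with App show ?case by (auto intro!: ap_D[of _ "tyof t" "tyof (s \<cdot> t)"] simp del: tyof.simps)
qed (simp_all add: env_in cn_D)

lemma ev_D' [simp]: "wt t \<Longrightarrow> tyof t = \<sigma> \<Longrightarrow> env D e \<Longrightarrow> ev ap cn e t \<in> D \<sigma>"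
  using ev_D by blast

lemma cn_D' [simp]: "cty c = \<sigma> \<Longrightarrow> cn c \<in> D \<sigma>"
  using cn_D by blast

text \<open>Beta conversion in the model, by the combinator equations: an occurrence of
  \<open>x\<close> is the identity S K K, a part without \<open>x\<close> is a constant function
  made with K, and S distributes the argument over an application.\<close>

lemma ev_lam:
  assumes "wt t" "env D e" "a \<in> D (snd x)"
  shows "ev ap cn e (lam x t) \<bullet> a = ev ap cn (e(x := a)) t"
  using assms(1)
proof (induction t)
  case (V y)
  show ?case
  proof (cases "y = x")
    case True
    let ?\<sigma> = "snd x"
    have "cn (S ?\<sigma> (?\<sigma> \<rightarrow> ?\<sigma>) ?\<sigma>) \<bullet> cn (K ?\<sigma> (?\<sigma> \<rightarrow> ?\<sigma>)) \<bullet> cn (K ?\<sigma> ?\<sigma>) \<bullet> a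
        = cn (K ?\<sigma> (?\<sigma> \<rightarrow> ?\<sigma>)) \<bullet> a \<bullet> (cn (K ?\<sigma> ?\<sigma>) \<bullet> a)"
      using assms(3) by (intro ap_S) auto
    also have "\<dots> = a"
      using assms(3) ap_D[of "cn (K ?\<sigma> ?\<sigma>)" ?\<sigma> "?\<sigma> \<rightarrow> ?\<sigma>" a] by (intro ap_K[of _ ?\<sigma> _ "?\<sigma> \<rightarrow> ?\<sigma>"]) auto
    finally show ?thesis using True by (simp add: lam.simps)
  next
    case False
    have "cn (K (snd y) (snd x)) \<bullet> e y \<bullet> a = e y"
      using assms by (intro ap_K) (simp_all add: env_in)
    with False show ?thesis by (simp add: lam.simps)
  qed
next
  case (C c)
  show ?case using ap_K[OF cn_D assms(3)] by (simp add: lam.simps)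
next
  case (App s t)
  then have ty: "tyof s = tyof t \<rightarrow> tyof (s \<cdot> t)" and w: "wt s" "wt t" "wt (s \<cdot> t)" by auto
  show ?case
  proof (cases "x \<in> tfv (s \<cdot> t)")
    case True
    have "cn (S (snd x) (tyof t) (tyof (s \<cdot> t))) \<bullet> ev ap cn e (lam x s) \<bullet> ev ap cn e (lam x t) \<bullet> a
       = ev ap cn e (lam x s) \<bullet> a \<bullet> (ev ap cn e (lam x t) \<bullet> a)"
      using assms(2,3) w ty by (intro ap_S ev_D') (simp_all del: tyof.simps)
    with True App.IH w show ?thesis by (simp add: lam.simps(3) del: tyof.simps)
  next
    case False
    have "cn (K (tyof (s \<cdot> t)) (snd x)) \<bullet> ev ap cn e (s \<cdot> t) \<bullet> a = ev ap cn e (s \<cdot> t)"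
      using assms(2,3) w by (intro ap_K ev_D') (simp_all del: tyof.simps)
    then show ?thesis
      unfolding ev_upd_fresh[OF False] using False by (simp add: lam.simps(3) del: tyof.simps tfv.simps)
  qed
qed

text \<open>A typed assignment from which all concrete environments are built by updates. The value
  \<open>undefined\<close> does no harm, since \<open>zero_t\<close> is closed; the assignment also
  shows each domain to be inhabited.\<close>

definition dflt :: "var \<Rightarrow> 'm" where
  "dflt x = ev ap cn undefined (zero_t (snd x))"

lemma env_dflt [simp]: "env D dflt"
proof -
  have "ev ap cn e (zero_t \<sigma>) \<in> D \<sigma>" for e \<sigma>
  proof (induction \<sigma>)
    case (Fun \<sigma> \<tau>)
    then show ?case by (simp, intro ap_D[of _ \<tau>]) simp_all
  next
    case (Prod \<sigma> \<tau>)
    then show ?case by (simp, intro ap_D[of _ \<tau> "\<sigma> \<otimes> \<tau>"] ap_D[of _ \<sigma>]) simp_all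
  qed auto
  then show ?thesis unfolding env_def dflt_def by blast
qed

definition val :: "trm \<Rightarrow> 'm" where
  "val t = ev ap cn dflt t"

lemma ev_closed: "tfv t = {} \<Longrightarrow> ev ap cn e t = val t"
  unfolding val_def by (rule ev_cong) simp

lemma ev_consts [simp]:
  "ev ap cn e pred_t = val pred_t" "ev ap cn e monus_t = val monus_t"
  "ev ap cn e (len_t \<sigma>) = val (len_t \<sigma>)" "ev ap cn e (append_t \<sigma>) = val (append_t \<sigma>)"
  "ev ap cn e (nth_t \<sigma>) = val (nth_t \<sigma>)" "ev ap cn e (init_t \<sigma>) = val (init_t \<sigma>)"
  "ev ap cn e (butlast_t \<sigma>) = val (butlast_t \<sigma>)" "ev ap cn e (last_t \<sigma>) = val (last_t \<sigma>)"
  "ev ap cn e (zero_t \<sigma>) = val (zero_t \<sigma>)"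
  by (simp_all add: ev_closed)

lemma val_D [simp]: "wt t \<Longrightarrow> tyof t = \<sigma> \<Longrightarrow> val t \<in> D \<sigma>"
  by (simp add: val_def)

abbreviation zero :: 'm where "zero \<equiv> cn Zero"
abbreviation suc :: "'m \<Rightarrow> 'm" where "suc n \<equiv> cn Succ \<bullet> n"
abbreviation monus :: "'m \<Rightarrow> 'm \<Rightarrow> 'm" where "monus m n \<equiv> val monus_t \<bullet> m \<bullet> n"
abbreviation ext :: "ty \<Rightarrow> 'm \<Rightarrow> 'm \<Rightarrow> 'm" where "ext \<sigma> a x \<equiv> cn (Ext \<sigma>) \<bullet> a \<bullet> x"

lemma suc_D [simp]: "n \<in> D \<N> \<Longrightarrow> suc n \<in> D \<N>"
  by (rule ap_D[of _ \<N>]) simp_all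

lemma suc_eq_iff [simp]: "m \<in> D \<N> \<Longrightarrow> n \<in> D \<N> \<Longrightarrow> suc m = suc n \<longleftrightarrow> m = n"
  using Succ_inject by blast

lemma suc_neq_zero [simp]: "n \<in> D \<N> \<Longrightarrow> suc n \<noteq> zero" "n \<in> D \<N> \<Longrightarrow> zero \<noteq> suc n"
  using Succ_neq_Zero by metis+

lemma ext_D [simp]: "a \<in> D (\<sigma>\<^sup>\<star>) \<Longrightarrow> x \<in> D \<sigma> \<Longrightarrow> ext \<sigma> a x \<in> D (\<sigma>\<^sup>\<star>)"
  by (rule ap_D[of _ \<sigma>], rule ap_D[of _ "\<sigma>\<^sup>\<star>"]) simp_all

lemma R_D [simp]: "\<lbrakk>a \<in> D \<sigma>; b \<in> D (\<sigma> \<rightarrow> \<N> \<rightarrow> \<sigma>); n \<in> D \<N>\<rbrakk> \<Longrightarrow> cn (R \<sigma>) \<bullet> a \<bullet> b \<bullet> n \<in> D \<sigma>"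
  by (rule ap_D[of _ \<N>], rule ap_D[of _ "\<sigma> \<rightarrow> \<N> \<rightarrow> \<sigma>"], rule ap_D[of _ \<sigma>]) simp_all

lemma L_D [simp]: "\<lbrakk>a \<in> D \<tau>; b \<in> D (\<tau> \<rightarrow> \<sigma>\<^sup>\<star> \<rightarrow> \<sigma> \<rightarrow> \<tau>); w \<in> D (\<sigma>\<^sup>\<star>)\<rbrakk>
    \<Longrightarrow> cn (L \<sigma> \<tau>) \<bullet> a \<bullet> b \<bullet> w \<in> D \<tau>"
  by (rule ap_D[of _ "\<sigma>\<^sup>\<star>"], rule ap_D[of _ "\<tau> \<rightarrow> \<sigma>\<^sup>\<star> \<rightarrow> \<sigma> \<rightarrow> \<tau>"], rule ap_D[of _ \<tau>]) simp_all

lemma monus_D [simp]: "m \<in> D \<N> \<Longrightarrow> n \<in> D \<N> \<Longrightarrow> monus m n \<in> D \<N>"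
  by (rule ap_D[of _ \<N>], rule ap_D[of _ \<N>]) (simp_all add: val_D)

lemma pred_D [simp]: "n \<in> D \<N> \<Longrightarrow> val pred_t \<bullet> n \<in> D \<N>"
  by (rule ap_D[of _ \<N>]) (simp_all add: val_D)

lemma len_D [simp]: "a \<in> D (\<sigma>\<^sup>\<star>) \<Longrightarrow> val (len_t \<sigma>) \<bullet> a \<in> D \<N>"
  by (rule ap_D[of _ "\<sigma>\<^sup>\<star>"]) (simp_all add: val_D)

lemma nth_D [simp]: "a \<in> D (\<sigma>\<^sup>\<star>) \<Longrightarrow> n \<in> D \<N> \<Longrightarrow> val (nth_t \<sigma>) \<bullet> a \<bullet> n \<in> D \<sigma>"
  by (rule ap_D[of _ \<N>], rule ap_D[of _ "\<sigma>\<^sup>\<star>"]) (simp_all add: val_D)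

lemma init_D [simp]: "v \<in> D (\<sigma>\<^sup>\<omega>) \<Longrightarrow> n \<in> D \<N> \<Longrightarrow> val (init_t \<sigma>) \<bullet> v \<bullet> n \<in> D (\<sigma>\<^sup>\<star>)"
  by (rule ap_D[of _ \<N>], rule ap_D[of _ "\<sigma>\<^sup>\<omega>"]) (simp_all add: val_D)

lemma butlast_D [simp]: "a \<in> D (\<sigma>\<^sup>\<star>) \<Longrightarrow> val (butlast_t \<sigma>) \<bullet> a \<in> D (\<sigma>\<^sup>\<star>)"
  by (rule ap_D[of _ "\<sigma>\<^sup>\<star>"]) (simp_all add: val_D)

lemma last_D [simp]: "a \<in> D (\<sigma>\<^sup>\<star>) \<Longrightarrow> val (last_t \<sigma>) \<bullet> a \<in> D \<sigma>"
  by (rule ap_D[of _ "\<sigma>\<^sup>\<star>"]) (simp_all add: val_D)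

text \<open>Applied to the defining equation of a term, this exposes its recursor and abstractions,
  so that \<open>ev_lam\<close> and the recursor axioms compute its values.\<close>

lemma val_eq: "t = s \<Longrightarrow> val t = ev ap cn dflt s"
  by (simp add: val_def)

lemma pred_suc [simp]: "n \<in> D \<N> \<Longrightarrow> val pred_t \<bullet> suc n = n"
  and pred_zero [simp]: "val pred_t \<bullet> zero = zero"
  unfolding val_eq[OF pred_t_def[unfolded Let_def]] by (simp_all add: ap_R_Succ ap_R_Zero ev_lam)

lemma monus_zero [simp]: "m \<in> D \<N> \<Longrightarrow> monus m zero = m"
  and monus_suc: "m \<in> D \<N> \<Longrightarrow> n \<in> D \<N> \<Longrightarrow> monus m (suc n) = val pred_t \<bullet> monus m n"
  unfolding val_eq[OF monus_t_def[unfolded Let_def]]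
  by (simp_all add: ev_lam ap_R_Succ ap_R_Zero)

lemma len_Empty [simp]: "val (len_t \<sigma>) \<bullet> cn (Empty \<sigma>) = zero"
  and len_ext [simp]: "a \<in> D (\<sigma>\<^sup>\<star>) \<Longrightarrow> x \<in> D \<sigma>
    \<Longrightarrow> val (len_t \<sigma>) \<bullet> ext \<sigma> a x = suc (val (len_t \<sigma>) \<bullet> a)"
  unfolding val_eq[OF len_t_def[unfolded Let_def]]
  by (simp_all add: ev_lam ap_L_Ext ap_L_Empty)

lemma append_ext_Empty [simp]: "a \<in> D (\<sigma>\<^sup>\<star>) \<Longrightarrow> x \<in> D \<sigma>
    \<Longrightarrow> val (append_t \<sigma>) \<bullet> a \<bullet> ext \<sigma> (cn (Empty \<sigma>)) x = ext \<sigma> a x"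
  unfolding val_eq[OF append_t_def[unfolded Let_def]]
  by (simp_all add: ev_lam ap_L_Ext ap_L_Empty)

lemma butlast_ext [simp]: "a \<in> D (\<sigma>\<^sup>\<star>) \<Longrightarrow> x \<in> D \<sigma> \<Longrightarrow> val (butlast_t \<sigma>) \<bullet> ext \<sigma> a x = a"
  unfolding val_eq[OF butlast_t_def[unfolded Let_def]]
  by (simp_all add: ev_lam ap_L_Ext)

lemma last_ext [simp]: "a \<in> D (\<sigma>\<^sup>\<star>) \<Longrightarrow> x \<in> D \<sigma> \<Longrightarrow> val (last_t \<sigma>) \<bullet> ext \<sigma> a x = x"
  unfolding val_eq[OF last_t_def[unfolded Let_def]]
  by (simp_all add: ev_lam ap_L_Ext)

lemma init_zero [simp]: "v \<in> D (\<sigma>\<^sup>\<omega>) \<Longrightarrow> val (init_t \<sigma>) \<bullet> v \<bullet> zero = cn (Empty \<sigma>)"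
  and init_suc [simp]: "v \<in> D (\<sigma>\<^sup>\<omega>) \<Longrightarrow> n \<in> D \<N>
    \<Longrightarrow> val (init_t \<sigma>) \<bullet> v \<bullet> suc n = ext \<sigma> (val (init_t \<sigma>) \<bullet> v \<bullet> n) (v \<bullet> n)"
  unfolding val_eq[OF init_t_def[unfolded Let_def]]
  by (simp_all add: ev_lam ap_R_Succ ap_R_Zero)

section \<open>Case analysis and induction on elements\<close>

lemma ext_eq_iff [simp]: "\<lbrakk>a \<in> D (\<sigma>\<^sup>\<star>); x \<in> D \<sigma>; b \<in> D (\<sigma>\<^sup>\<star>); y \<in> D \<sigma>\<rbrakk>
    \<Longrightarrow> ext \<sigma> a x = ext \<sigma> b y \<longleftrightarrow> a = b \<and> x = y"
  using butlast_ext last_ext by metis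

lemma ext_neq_Empty [simp]: "a \<in> D (\<sigma>\<^sup>\<star>) \<Longrightarrow> x \<in> D \<sigma> \<Longrightarrow> ext \<sigma> a x \<noteq> cn (Empty \<sigma>)"
  using len_ext len_Empty len_D suc_neq_zero(1) by metis

text \<open>Induction is used merely as case analysis. Stating the second case with
  \<open>butlast_t\<close> and \<open>last_t\<close> keeps the formula free of quantifiers.\<close>

lemma seq_cases:
  assumes "a \<in> D (\<sigma>\<^sup>\<star>)"
  shows "a = cn (Empty \<sigma>) \<or> a = ext \<sigma> (val (butlast_t \<sigma>) \<bullet> a) (val (last_t \<sigma>) \<bullet> a)"
proof -
  let ?a = "(''a'', \<sigma>\<^sup>\<star>)"
  have "sat D ap cn (dflt(?a := a))
      (V ?a \<doteq> C (Empty \<sigma>) \<^bold>\<or> V ?a \<doteq> C (Ext \<sigma>) \<cdot> (butlast_t \<sigma> \<cdot> V ?a) \<cdot> (last_t \<sigma> \<cdot> V ?a))"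
    by (rule seq_induct[where \<sigma> = \<sigma>]) (use assms in \<open>auto simp: Par_def\<close>)
  then show ?thesis by simp
qed

text \<open>Separates the predicate \<open>P\<close> used in reasoning from the formula
  \<open>A\<close> that has to define it. Data from the model enter through the environment
  \<open>e\<close>.\<close>

lemma nat_ind:
  assumes "\<And>m. m \<in> D \<N> \<Longrightarrow> sat D ap cn (e(x := m)) A \<longleftrightarrow> P m"
    and "wff A" "bv A \<inter> Par = {}" "x \<notin> Par" "snd x = \<N>" "env D e"
    and "P zero" "\<And>m. \<lbrakk>m \<in> D \<N>; P m\<rbrakk> \<Longrightarrow> P (suc m)" "n \<in> D \<N>"
  shows "P n"
  using nat_induct[of A x e n] assms by simp

lemma nat_cases:
  assumes "n \<in> D \<N>"
  obtains "n = zero" | m where "m \<in> D \<N>" "n = suc m"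
proof -
  let ?n = "(''n'', \<N>)"
  have "n = zero \<or> n = suc (val pred_t \<bullet> n)"
    by (rule nat_ind[where x = ?n and e = dflt and A = "V ?n \<doteq> C Zero \<^bold>\<or> V ?n \<doteq> C Succ \<cdot> (pred_t \<cdot> V ?n)"])
      (use assms in \<open>auto simp: Par_def\<close>)
  then show thesis using that assms pred_D by blast
qed


section \<open>Arithmetic in a model\<close>

text \<open>Subtraction recurses on its second argument, so the induction is on \<open>n\<close>,
  with \<open>m\<close> held fixed in the environment.\<close>

lemma monus_suc_suc [simp]:
  assumes "m \<in> D \<N>" "n \<in> D \<N>"
  shows "monus (suc m) (suc n) = monus m n"
proof -
  let ?m = "(''m'', \<N>)" and ?n = "(''n'', \<N>)"
  show ?thesis
    by (rule nat_ind[where x = ?n and e = "dflt(?m := m)"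
          and A = "monus_t \<cdot> (C Succ \<cdot> V ?m) \<cdot> (C Succ \<cdot> V ?n) \<doteq> monus_t \<cdot> V ?m \<cdot> V ?n"])
      (use assms in \<open>auto simp: Par_def monus_suc\<close>)
qed

lemma zero_monus [simp]:
  assumes "n \<in> D \<N>"
  shows "monus zero n = zero"
proof -
  let ?n = "(''n'', \<N>)"
  show ?thesis
    by (rule nat_ind[where x = ?n and e = dflt and A = "monus_t \<cdot> C Zero \<cdot> V ?n \<doteq> C Zero"])
      (use assms in \<open>auto simp: Par_def monus_suc\<close>)
qed

lemma monus_self [simp]:
  assumes "n \<in> D \<N>"
  shows "monus n n = zero"
proof -
  let ?n = "(''n'', \<N>)"
  show ?thesis
    by (rule nat_ind[where x = ?n and e = dflt and A = "monus_t \<cdot> V ?n \<cdot> V ?n \<doteq> C Zero"])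
      (use assms in \<open>auto simp: Par_def\<close>)
qed

definition le :: "'m \<Rightarrow> 'm \<Rightarrow> bool" where
  "le m n \<longleftrightarrow> monus m n = zero"

definition lt :: "'m \<Rightarrow> 'm \<Rightarrow> bool" where
  "lt m n \<longleftrightarrow> le (suc m) n"

lemma sat_le [simp]: "sat D ap cn e (s \<preceq> t) \<longleftrightarrow> le (ev ap cn e s) (ev ap cn e t)"
  by (simp add: le_fm_def le_def)

lemma sat_less [simp]: "sat D ap cn e (s \<prec> t) \<longleftrightarrow> lt (ev ap cn e s) (ev ap cn e t)"
  by (simp add: less_fm_def lt_def)

lemma le_simps [simp]:
  "n \<in> D \<N> \<Longrightarrow> le zero n"
  "n \<in> D \<N> \<Longrightarrow> le n n"
  "n \<in> D \<N> \<Longrightarrow> \<not> le (suc n) zero"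
  "m \<in> D \<N> \<Longrightarrow> n \<in> D \<N> \<Longrightarrow> le (suc m) (suc n) \<longleftrightarrow> le m n"
  "n \<in> D \<N> \<Longrightarrow> le n zero \<longleftrightarrow> n = zero"
  by (simp_all add: le_def)

lemma le_suc [simp]: "n \<in> D \<N> \<Longrightarrow> le n (suc n)"
  by (simp add: le_def monus_suc)

lemma lt_simps [simp]:
  "n \<in> D \<N> \<Longrightarrow> \<not> lt n zero"
  "n \<in> D \<N> \<Longrightarrow> lt zero (suc n)"
  "m \<in> D \<N> \<Longrightarrow> n \<in> D \<N> \<Longrightarrow> lt (suc m) (suc n) \<longleftrightarrow> lt m n"
  "m \<in> D \<N> \<Longrightarrow> n \<in> D \<N> \<Longrightarrow> lt m (suc n) \<longleftrightarrow> le m n"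
  by (simp_all add: lt_def)

text \<open>The second number is quantified inside the induction formula because the step passes to
  the predecessors of both numbers. The same holds for transitivity and antisymmetry below.\<close>

lemma le_or_lt:
  assumes "m \<in> D \<N>" "n \<in> D \<N>"
  shows "le m n \<or> lt n m"
proof -
  let ?m = "(''m'', \<N>)" and ?n = "(''n'', \<N>)"
  have "\<forall>n\<in>D \<N>. le m n \<or> lt n m"
  proof (rule nat_ind[where x = ?m and e = dflt and A = "\<^bold>\<forall>?n. V ?m \<preceq> V ?n \<^bold>\<or> V ?n \<prec> V ?m"])
    fix m assume m: "m \<in> D \<N>" and IH: "\<forall>n\<in>D \<N>. le m n \<or> lt n m"
    show "\<forall>n\<in>D \<N>. le (suc m) n \<or> lt n (suc m)"
    proof
      fix n assume "n \<in> D \<N>"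
      then show "le (suc m) n \<or> lt n (suc m)"
        by (cases rule: nat_cases) (use m IH in \<open>auto simp: lt_def\<close>)
    qed
  qed (use assms in \<open>auto simp: Par_def\<close>)
  with assms show ?thesis by blast
qed

lemma le_trans:
  assumes "i \<in> D \<N>" "j \<in> D \<N>" "k \<in> D \<N>" "le i j" "le j k"
  shows "le i k"
proof -
  let ?i = "(''i'', \<N>)" and ?j = "(''j'', \<N>)" and ?k = "(''k'', \<N>)"
  have "\<forall>j\<in>D \<N>. \<forall>k\<in>D \<N>. le i j \<and> le j k \<longrightarrow> le i k"
  proof (rule nat_ind[where x = ?i and e = dflt
        and A = "\<^bold>\<forall>?j. \<^bold>\<forall>?k. V ?i \<preceq> V ?j \<^bold>\<and> V ?j \<preceq> V ?k \<^bold>\<longrightarrow> V ?i \<preceq> V ?k"])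
    fix i assume i: "i \<in> D \<N>" and IH: "\<forall>j\<in>D \<N>. \<forall>k\<in>D \<N>. le i j \<and> le j k \<longrightarrow> le i k"
    show "\<forall>j\<in>D \<N>. \<forall>k\<in>D \<N>. le (suc i) j \<and> le j k \<longrightarrow> le (suc i) k"
    proof (intro ballI impI)
      fix j k assume j: "j \<in> D \<N>" and k: "k \<in> D \<N>" and h: "le (suc i) j \<and> le j k"
      then obtain j' where j': "j' \<in> D \<N>" "j = suc j'" using i by (elim nat_cases[of j]) auto
      with h k obtain k' where k': "k' \<in> D \<N>" "k = suc k'" by (elim nat_cases[of k]) auto
      have "le i j'" "le j' k'" using h i j' k' by simp_all
      then have "le i k'" using IH j'(1) k'(1) by blast
      then show "le (suc i) k" using i k' by simp
    qed
  qed (use assms in \<open>auto simp: Par_def\<close>)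
  with assms show ?thesis by blast
qed

lemma le_antisym:
  assumes "i \<in> D \<N>" "j \<in> D \<N>" "le i j" "le j i"
  shows "i = j"
proof -
  let ?i = "(''i'', \<N>)" and ?j = "(''j'', \<N>)"
  have "\<forall>j\<in>D \<N>. le i j \<and> le j i \<longrightarrow> i = j"
  proof (rule nat_ind[where x = ?i and e = dflt
        and A = "\<^bold>\<forall>?j. V ?i \<preceq> V ?j \<^bold>\<and> V ?j \<preceq> V ?i \<^bold>\<longrightarrow> V ?i \<doteq> V ?j"])
    fix i assume i: "i \<in> D \<N>" and IH: "\<forall>j\<in>D \<N>. le i j \<and> le j i \<longrightarrow> i = j"
    show "\<forall>j\<in>D \<N>. le (suc i) j \<and> le j (suc i) \<longrightarrow> suc i = j"
    proof (intro ballI impI)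
      fix j assume "j \<in> D \<N>" and h: "le (suc i) j \<and> le j (suc i)"
      then obtain j' where j': "j' \<in> D \<N>" "j = suc j'" using i by (elim nat_cases[of j]) auto
      then have "le i j'" "le j' i" using h i by simp_all
      then have "i = j'" using IH j'(1) by blast
      then show "suc i = j" using j' by simp
    qed
  qed (use assms in \<open>auto simp: Par_def\<close>)
  with assms show ?thesis by blast
qed

text \<open>This is what makes the index shift m - G in the tail of the sequence \<open>q\<close>
  preserve strict order.\<close>

lemma monus_less_mono:
  assumes "g \<in> D \<N>" "i \<in> D \<N>" "k \<in> D \<N>" "le g i" "lt i k"
  shows "lt (monus i g) (monus k g)"
proof -
  let ?g = "(''g'', \<N>)" and ?i = "(''i'', \<N>)" and ?k = "(''k'', \<N>)"
  let ?P = "\<lambda>g. \<forall>i\<in>D \<N>. \<forall>k\<in>D \<N>. le g i \<and> lt i k \<longrightarrow> lt (monus i g) (monus k g)"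
  have step: "?P (suc g)" if g: "g \<in> D \<N>" and IH: "?P g" for g
  proof (intro ballI impI)
    fix i k assume i: "i \<in> D \<N>" and k: "k \<in> D \<N>" and h: "le (suc g) i \<and> lt i k"
    have "i \<noteq> zero" using h g by auto
    with i obtain i' where i': "i' \<in> D \<N>" "i = suc i'" by (metis nat_cases)
    have "k \<noteq> zero" using h i by auto
    with k obtain k' where k': "k' \<in> D \<N>" "k = suc k'" by (metis nat_cases)
    have "le g i'" "lt i' k'" using h g i' k' by (simp_all only: le_simps lt_simps(3))
    then have "lt (monus i' g) (monus k' g)" using IH i'(1) k'(1) by blast
    then show "lt (monus i (suc g)) (monus k (suc g))" using g i' k' by simp
  qed
  have "?P g"
    by (rule nat_ind[where x = ?g and e = dflt and P = ?P
        and A = "\<^bold>\<forall>?i. \<^bold>\<forall>?k. V ?g \<preceq> V ?i \<^bold>\<and> V ?i \<prec> V ?k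
          \<^bold>\<longrightarrow> monus_t \<cdot> V ?i \<cdot> V ?g \<prec> monus_t \<cdot> V ?k \<cdot> V ?g"])
      (use assms(1) step in \<open>simp_all add: Par_def\<close>)
  with assms show ?thesis by blast
qed

lemma lt_le: "i \<in> D \<N> \<Longrightarrow> j \<in> D \<N> \<Longrightarrow> lt i j \<Longrightarrow> le i j"
  unfolding lt_def using le_trans[of i "suc i" j] by simp

text \<open>Subtracting \<open>i\<close> from both sides of i < i would give 0 < 0.\<close>

lemma lt_irrefl: "i \<in> D \<N> \<Longrightarrow> \<not> lt i i"
  using monus_less_mono[of i i i] by auto

lemma le_lt_trans: "\<lbrakk>i \<in> D \<N>; j \<in> D \<N>; k \<in> D \<N>; le i j; lt j k\<rbrakk> \<Longrightarrow> lt i k"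
  unfolding lt_def using le_trans[of "suc i" "suc j" k] by simp

lemma lt_le_trans: "\<lbrakk>i \<in> D \<N>; j \<in> D \<N>; k \<in> D \<N>; lt i j; le j k\<rbrakk> \<Longrightarrow> lt i k"
  unfolding lt_def using le_trans[of "suc i" j k] by simp

lemma not_lt: "i \<in> D \<N> \<Longrightarrow> j \<in> D \<N> \<Longrightarrow> \<not> lt i j \<longleftrightarrow> le j i"
  using le_or_lt lt_irrefl le_lt_trans by blast

lemma le_cases: "i \<in> D \<N> \<Longrightarrow> j \<in> D \<N> \<Longrightarrow> le i j \<Longrightarrow> lt i j \<or> i = j"
  using not_lt le_antisym by blast

lemma le_iff: "i \<in> D \<N> \<Longrightarrow> j \<in> D \<N> \<Longrightarrow> le i j \<longleftrightarrow> lt i j \<or> i = j"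
  using le_cases lt_le by auto

end


section \<open>Embeddability and bad sequences in a model\<close>

text \<open>Evaluation below a quantifier updates the environment at the bound variable; these
  inequalities show that the interpretation of the order survives all such updates.\<close>

lemma le_var_neq [simp]: "le_var X \<noteq> (CHR ''h'' # s, \<sigma>)" "le_var X \<noteq> (CHR ''i'' # s, \<sigma>)"
  "le_var X \<noteq> (CHR ''k'' # s, \<sigma>)" "le_var X \<noteq> (CHR ''u'' # s, \<sigma>)"
  "le_var X \<noteq> (CHR ''p'' # s, \<sigma>)" "le_var X \<noteq> (CHR ''f'' # s, \<sigma>)"
  "le_var X \<noteq> (CHR ''n'' # s, \<sigma>)" "le_var X \<noteq> (CHR ''j'' # s, \<sigma>)"
  "le_var X \<noteq> (CHR ''q'' # s, \<sigma>)" "le_var X \<noteq> (CHR ''x'' # s, \<sigma>)"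
  "le_var X \<noteq> (CHR ''g'' # s, \<sigma>)" "le_var X \<noteq> (CHR ''c'' # s, \<sigma>)"
  by (simp_all add: le_var_def)

lemma snd_le_var [simp]: "snd (le_var X) = X \<rightarrow> X \<rightarrow> \<N>"
  by (simp add: le_var_def)

lemma wff_theta [simp]:
  assumes "wt v" "tyof v = (X\<^sup>\<star>)\<^sup>\<omega>" "wt j" "tyof j = \<N>"
  shows "wff (theta X v j)"
  using assms by (simp add: theta_def embeds_def leX_def Let_def)

lemma bv_theta [simp]: "bv (theta X v j) \<inter> Par = {}"
  by (auto simp: theta_def embeds_def leX_def Let_def Par_def)

context pa_model
begin

text \<open>The recursor as a case distinction on whether \<open>c\<close> is zero.\<close>

lemma ev_cond:
  assumes "wt b" "tyof b = \<sigma>" "env D e" "snd y = \<sigma>" "snd k = \<N>" "y \<notin> tfv b" "k \<notin> tfv b"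
    and "a \<in> D \<sigma>" and c: "c \<in> D \<N>"
  shows "cn (R \<sigma>) \<bullet> a \<bullet> ev ap cn e (\<^bold>\<lambda>y. \<^bold>\<lambda>k. b) \<bullet> c = (if c = zero then a else ev ap cn e b)"
  using c
proof (cases rule: nat_cases)
  case 1
  with assms show ?thesis by (simp add: ap_R_Zero)
next
  case (2 m)
  have "cn (R \<sigma>) \<bullet> a \<bullet> ev ap cn e (\<^bold>\<lambda>y. \<^bold>\<lambda>k. b) \<bullet> m \<in> D \<sigma>" using assms 2 by simp
  with assms 2 show ?thesis by (simp add: ap_R_Succ ev_lam ev_upd_fresh del: fun_upd_apply)
qed

lemma nth_ext [simp]:
  assumes "a \<in> D (\<sigma>\<^sup>\<star>)" "x \<in> D \<sigma>" "i \<in> D \<N>"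
  shows "val (nth_t \<sigma>) \<bullet> ext \<sigma> a x \<bullet> i
    = (if lt i (val (len_t \<sigma>) \<bullet> a) then val (nth_t \<sigma>) \<bullet> a \<bullet> i else x)"
proof -
  have "lt i (val (len_t \<sigma>) \<bullet> a) \<longleftrightarrow> monus (val (len_t \<sigma>) \<bullet> a) i \<noteq> zero"
    using not_lt[of i "val (len_t \<sigma>) \<bullet> a"] assms unfolding le_def by auto
  then show ?thesis
    unfolding val_eq[OF nth_t_def[unfolded Let_def]]
    using assms by (simp add: ev_lam ap_L_Ext ev_cond del: zero_t.simps)
qed

text \<open>The order appears as an element \<open>l\<close> of the model, which frees the
  combinatorial argument from environments. The map \<open>h\<close> ranges over the functions of
  the model only.\<close>

definition emb :: "ty \<Rightarrow> 'm \<Rightarrow> 'm \<Rightarrow> 'm \<Rightarrow> bool" where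
  "emb X l a b \<longleftrightarrow> (\<exists>h\<in>D (\<N> \<rightarrow> \<N>).
     (\<forall>i\<in>D \<N>. lt i (val (len_t X) \<bullet> a) \<longrightarrow> lt (h \<bullet> i) (val (len_t X) \<bullet> b)) \<and>
     (\<forall>i\<in>D \<N>. \<forall>k\<in>D \<N>. lt i k \<and> lt k (val (len_t X) \<bullet> a) \<longrightarrow> lt (h \<bullet> i) (h \<bullet> k)) \<and>
     (\<forall>i\<in>D \<N>. lt i (val (len_t X) \<bullet> a)
       \<longrightarrow> l \<bullet> (val (nth_t X) \<bullet> a \<bullet> i) \<bullet> (val (nth_t X) \<bullet> b \<bullet> (h \<bullet> i)) = zero))"

definition bad :: "ty \<Rightarrow> 'm \<Rightarrow> 'm \<Rightarrow> 'm \<Rightarrow> bool" where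
  "bad X l v j \<longleftrightarrow> (\<forall>i\<in>D \<N>. \<forall>k\<in>D \<N>. lt i k \<and> le k j \<longrightarrow> \<not> emb X l (v \<bullet> i) (v \<bullet> k))"

lemma sat_embeds:
  assumes "(''h'', \<N> \<rightarrow> \<N>) \<notin> tfv a \<union> tfv b" "(''i'', \<N>) \<notin> tfv a \<union> tfv b" "(''k'', \<N>) \<notin> tfv a \<union> tfv b"
  shows "sat D ap cn e (embeds X a b)
    \<longleftrightarrow> emb X (e (le_var X)) (ev ap cn e a) (ev ap cn e b)"
  using assms by (simp add: embeds_def leX_def emb_def Let_def ev_upd_fresh)

text \<open>The excluded names are those bound in the formula, which would otherwise capture
  variables of the two terms.\<close>

lemma sat_theta:
  assumes "{(''h'', \<N> \<rightarrow> \<N>), (''i'', \<N>), (''k'', \<N>), (''i0'', \<N>), (''i1'', \<N>)}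
    \<inter> (tfv v \<union> tfv j) = {}"
  shows "sat D ap cn e (theta X v j) \<longleftrightarrow> bad X (e (le_var X)) (ev ap cn e v) (ev ap cn e j)"
  using assms by (simp add: theta_def bad_def Let_def sat_embeds ev_upd_fresh)

lemma emb_Empty:
  assumes "b \<in> D (X\<^sup>\<star>)"
  shows "emb X l (cn (Empty X)) b"
  unfolding emb_def using env_in[OF env_dflt, of "(''h'', \<N> \<rightarrow> \<N>)"] by auto

text \<open>The same map works: it only hits positions below the length of \<open>b\<close>, where
  the longer word has the same entries.\<close>

lemma emb_ext_right:
  assumes "a \<in> D (X\<^sup>\<star>)" "b \<in> D (X\<^sup>\<star>)" "y \<in> D X" "emb X l a b"
  shows "emb X l a (ext X b y)"
proof -
  obtain h where h: "h \<in> D (\<N> \<rightarrow> \<N>)"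
    and bound: "\<And>i. i \<in> D \<N> \<Longrightarrow> lt i (val (len_t X) \<bullet> a) \<Longrightarrow> lt (h \<bullet> i) (val (len_t X) \<bullet> b)"
    and mono: "\<forall>i\<in>D \<N>. \<forall>k\<in>D \<N>. lt i k \<and> lt k (val (len_t X) \<bullet> a) \<longrightarrow> lt (h \<bullet> i) (h \<bullet> k)"
    and entry: "\<And>i. i \<in> D \<N> \<Longrightarrow> lt i (val (len_t X) \<bullet> a)
      \<Longrightarrow> l \<bullet> (val (nth_t X) \<bullet> a \<bullet> i) \<bullet> (val (nth_t X) \<bullet> b \<bullet> (h \<bullet> i)) = zero"
    using assms(4) unfolding emb_def by blast
  have hD: "i \<in> D \<N> \<Longrightarrow> h \<bullet> i \<in> D \<N>" for i using ap_D h by blast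
  show ?thesis
    unfolding emb_def
  proof (rule bexI[OF _ h], intro conjI mono ballI impI)
    fix i assume i: "i \<in> D \<N>" "lt i (val (len_t X) \<bullet> a)"
    show "lt (h \<bullet> i) (val (len_t X) \<bullet> ext X b y)"
      using bound[OF i] lt_le hD i assms by simp
    show "l \<bullet> (val (nth_t X) \<bullet> a \<bullet> i) \<bullet> (val (nth_t X) \<bullet> ext X b y \<bullet> (h \<bullet> i)) = zero"
      using bound[OF i] entry[OF i] hD i assms by simp
  qed
qed

text \<open>The map is prolonged by sending the new last position |a| to the new last position |b|.
  All earlier values lie below |b|, so it stays strictly increasing.\<close>

lemma emb_ext_ext:
  assumes ab: "a \<in> D (X\<^sup>\<star>)" "b \<in> D (X\<^sup>\<star>)" and xy: "x \<in> D X" "y \<in> D X"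
    and "emb X l a b" and le: "l \<bullet> x \<bullet> y = zero"
  shows "emb X l (ext X a x) (ext X b y)"
proof -
  let ?la = "val (len_t X) \<bullet> a" and ?lb = "val (len_t X) \<bullet> b"
  obtain h where h: "h \<in> D (\<N> \<rightarrow> \<N>)"
    and bound: "\<And>i. i \<in> D \<N> \<Longrightarrow> lt i ?la \<Longrightarrow> lt (h \<bullet> i) ?lb"
    and mono: "\<And>i k. \<lbrakk>i \<in> D \<N>; k \<in> D \<N>; lt i k; lt k ?la\<rbrakk> \<Longrightarrow> lt (h \<bullet> i) (h \<bullet> k)"
    and entry: "\<And>i. i \<in> D \<N> \<Longrightarrow> lt i ?la
      \<Longrightarrow> l \<bullet> (val (nth_t X) \<bullet> a \<bullet> i) \<bullet> (val (nth_t X) \<bullet> b \<bullet> (h \<bullet> i)) = zero"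
    using assms(5) unfolding emb_def by blast
  have hD: "i \<in> D \<N> \<Longrightarrow> h \<bullet> i \<in> D \<N>" for i using ap_D h by blast
  have la: "?la \<in> D \<N>" and lb: "?lb \<in> D \<N>" using ab by simp_all
  let ?h = "(''h'', \<N> \<rightarrow> \<N>)" and ?a = "(''a'', X\<^sup>\<star>)" and ?b = "(''b'', X\<^sup>\<star>)"
    and ?i = "(''i'', \<N>)" and ?y = "(''y'', \<N>)" and ?k = "(''k'', \<N>)"
  define e where "e = dflt(?h := h, ?a := a, ?b := b)"
  \<comment> \<open>The prolonged map has to be an element of the model, so it is written as a term:
    the recursor tests |a| - i, returning |b| when this is zero and \<open>h\<close> at i
    otherwise.\<close>
  define h' where "h' = ev ap cn e (\<^bold>\<lambda>?i. C (R \<N>) \<cdot> (len_t X \<cdot> V ?b) \<cdot> (\<^bold>\<lambda>?y. \<^bold>\<lambda>?k. V ?h \<cdot> V ?i)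
    \<cdot> (monus_t \<cdot> (len_t X \<cdot> V ?a) \<cdot> V ?i))"
  have e: "env D e" unfolding e_def using ab h by (intro env_upd env_dflt) simp_all
  have e_vals: "e ?h = h" "e ?a = a" "e ?b = b" by (simp_all add: e_def)
  have h'D: "h' \<in> D (\<N> \<rightarrow> \<N>)" unfolding h'_def using e by (intro ev_D') simp_all
  have h': "h' \<bullet> i = (if lt i ?la then h \<bullet> i else ?lb)" if "i \<in> D \<N>" for i
    using that ab hD[OF that] e not_lt[OF that la]
    unfolding h'_def le_def by (auto simp: ev_lam ev_cond e_vals)
  show ?thesis
    unfolding emb_def
  proof (rule bexI[OF _ h'D], intro conjI ballI impI)
    fix i assume i: "i \<in> D \<N>" and *: "lt i (val (len_t X) \<bullet> ext X a x)"
    then have lt: "lt i (suc ?la)" using ab xy by simp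
    have bd: "lt i ?la \<Longrightarrow> lt (h \<bullet> i) ?lb" using bound i by blast
    show "lt (h' \<bullet> i) (val (len_t X) \<bullet> ext X b y)"
      using bd lt_le[OF hD[OF i] lb] hD[OF i] i lb ab xy by (simp add: h')
    show "l \<bullet> (val (nth_t X) \<bullet> ext X a x \<bullet> i) \<bullet> (val (nth_t X) \<bullet> ext X b y \<bullet> (h' \<bullet> i)) = zero"
      using bd entry[OF i] le lt_irrefl[OF lb] hD[OF i] i lb ab xy by (simp add: h')
  next
    fix i k assume ik: "i \<in> D \<N>" "k \<in> D \<N>" and "lt i k \<and> lt k (val (len_t X) \<bullet> ext X a x)"
    then have lt: "lt i k" "le k ?la" using ab xy by simp_all
    then have i: "lt i ?la" using ik la lt_le_trans by blast
    show "lt (h' \<bullet> i) (h' \<bullet> k)"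
      using mono[OF ik lt(1)] bound[OF ik(1) i] i ik by (simp add: h')
  qed
qed

text \<open>By injectivity of \<open>Ext\<close>, one more index adds one more equation of entries.
  This converts between the segments mentioned in \<open>MB\<close> and entrywise agreement, in both
  directions. The equivalence is coded as two implications because the language has no
  biconditional.\<close>

lemma init_eq_iff:
  assumes v: "v \<in> D (\<sigma>\<^sup>\<omega>)" and w: "w \<in> D (\<sigma>\<^sup>\<omega>)" and n: "n \<in> D \<N>"
  shows "val (init_t \<sigma>) \<bullet> v \<bullet> n = val (init_t \<sigma>) \<bullet> w \<bullet> n \<longleftrightarrow> (\<forall>i\<in>D \<N>. lt i n \<longrightarrow> v \<bullet> i = w \<bullet> i)"
    (is "?P n")
proof -
  let ?v = "(''v'', \<sigma>\<^sup>\<omega>)" and ?w = "(''w'', \<sigma>\<^sup>\<omega>)" and ?n = "(''n'', \<N>)" and ?i = "(''i'', \<N>)"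
  let ?I = "init_t \<sigma> \<cdot> V ?v \<cdot> V ?n \<doteq> init_t \<sigma> \<cdot> V ?w \<cdot> V ?n"
    and ?J = "\<^bold>\<forall>?i. V ?i \<prec> V ?n \<^bold>\<longrightarrow> V ?v \<cdot> V ?i \<doteq> V ?w \<cdot> V ?i"
  have vw: "n \<in> D \<N> \<Longrightarrow> v \<bullet> n \<in> D \<sigma>" "n \<in> D \<N> \<Longrightarrow> w \<bullet> n \<in> D \<sigma>" for n
    using ap_D v w by blast+
  have step: "?P (suc m)" if m: "m \<in> D \<N>" and IH: "?P m" for m
  proof -
    have "(\<forall>i\<in>D \<N>. lt i (suc m) \<longrightarrow> v \<bullet> i = w \<bullet> i)
        \<longleftrightarrow> (\<forall>i\<in>D \<N>. lt i m \<longrightarrow> v \<bullet> i = w \<bullet> i) \<and> v \<bullet> m = w \<bullet> m"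
      using m by (auto simp: le_iff)
    then show ?thesis using IH m v w vw by simp
  qed
  show ?thesis
    by (rule nat_ind[where x = ?n and e = "dflt(?v := v, ?w := w)" and P = ?P
          and A = "(?I \<^bold>\<longrightarrow> ?J) \<^bold>\<and> (?J \<^bold>\<longrightarrow> ?I)"])
      (use v w n step in \<open>auto simp: Par_def\<close>)
qed

text \<open>The step function K p discards the accumulated value and returns the entry of
  \<open>p\<close> at the predecessor, so the recursor merely shifts the sequence by one.\<close>

lemma prev_simps:
  assumes "u \<in> D \<sigma>" "p \<in> D (\<sigma>\<^sup>\<omega>)"
  shows "cn (R \<sigma>) \<bullet> u \<bullet> (cn (K (\<N> \<rightarrow> \<sigma>) \<sigma>) \<bullet> p) \<bullet> zero = u"
    and "n \<in> D \<N> \<Longrightarrow> cn (R \<sigma>) \<bullet> u \<bullet> (cn (K (\<N> \<rightarrow> \<sigma>) \<sigma>) \<bullet> p) \<bullet> suc n = p \<bullet> n"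
proof -
  have Kp: "cn (K (\<N> \<rightarrow> \<sigma>) \<sigma>) \<bullet> p \<in> D (\<sigma> \<rightarrow> \<N> \<rightarrow> \<sigma>)"
    by (rule ap_D[of _ "\<N> \<rightarrow> \<sigma>"]) (use assms in simp_all)
  then show "cn (R \<sigma>) \<bullet> u \<bullet> (cn (K (\<N> \<rightarrow> \<sigma>) \<sigma>) \<bullet> p) \<bullet> zero = u"
    using assms by (simp add: ap_R_Zero)
  assume n: "n \<in> D \<N>"
  show "cn (R \<sigma>) \<bullet> u \<bullet> (cn (K (\<N> \<rightarrow> \<sigma>) \<sigma>) \<bullet> p) \<bullet> suc n = p \<bullet> n"
    using assms Kp n ap_K[OF assms(2) R_D[OF assms(1) Kp n]] by (simp add: ap_R_Succ)
qed


section \<open>The minimal bad sequence argument\<close>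

lemma wqo_of_minimal_bad:
  fixes X :: ty and l u p f :: 'm
  defines "W \<equiv> X\<^sup>\<star>"
  assumes l: "l \<in> D (X \<rightarrow> X \<rightarrow> \<N>)"
    and ram: "\<forall>x\<in>D (X\<^sup>\<omega>). \<exists>g\<in>D (\<N> \<rightarrow> \<N>). \<forall>k\<in>D \<N>. \<forall>i\<in>D \<N>. \<forall>j\<in>D \<N>. lt i j \<and> le j k \<longrightarrow>
      lt (g \<bullet> i) (g \<bullet> j) \<and> l \<bullet> (x \<bullet> (g \<bullet> i)) \<bullet> (x \<bullet> (g \<bullet> j)) = zero"
    and u: "u \<in> D (W\<^sup>\<omega>)" and p: "p \<in> D ((W\<^sup>\<omega>)\<^sup>\<omega>)"
    and mb: "\<forall>n\<in>D \<N>. \<forall>j\<in>D \<N>. \<forall>q\<in>D (W\<^sup>\<omega>).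
      val (init_t W) \<bullet> (cn (R (W\<^sup>\<omega>)) \<bullet> u \<bullet> (cn (K (\<N> \<rightarrow> W\<^sup>\<omega>) (W\<^sup>\<omega>)) \<bullet> p) \<bullet> n) \<bullet> n
        = val (init_t W) \<bullet> (p \<bullet> n) \<bullet> n \<and>
      (bad X l (cn (R (W\<^sup>\<omega>)) \<bullet> u \<bullet> (cn (K (\<N> \<rightarrow> W\<^sup>\<omega>) (W\<^sup>\<omega>)) \<bullet> p) \<bullet> n) j
        \<longrightarrow> bad X l (p \<bullet> n) j) \<and>
      (val (init_t W) \<bullet> q \<bullet> n = val (init_t W) \<bullet> (p \<bullet> n) \<bullet> n \<and>
        (\<exists>c\<in>D W. c \<noteq> cn (Empty X) \<and> p \<bullet> n \<bullet> n = val (append_t X) \<bullet> (q \<bullet> n) \<bullet> c)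
        \<longrightarrow> \<not> bad X l q (f \<bullet> n \<bullet> q))"
  shows "\<exists>j\<in>D \<N>. \<not> bad X l u j"
proof (rule ccontr)
  assume "\<not> (\<exists>j\<in>D \<N>. \<not> bad X l u j)"
  then have bad_u: "j \<in> D \<N> \<Longrightarrow> bad X l u j" for j by blast
  let ?len = "val (len_t X)" and ?init = "val (init_t W)"
  let ?p = "(''p'', (W\<^sup>\<omega>)\<^sup>\<omega>)" and ?n = "(''n'', \<N>)" and ?i = "(''i'', \<N>)" and ?j = "(''j'', \<N>)"
    and ?g = "(''g'', \<N> \<rightarrow> \<N>)" and ?m = "(''m'', \<N>)" and ?y = "(''y'', W)" and ?k = "(''k'', \<N>)"
  have pn [simp]: "n \<in> D \<N> \<Longrightarrow> p \<bullet> n \<in> D (W\<^sup>\<omega>)" for n using ap_D p by blast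
  have pnm [simp]: "n \<in> D \<N> \<Longrightarrow> m \<in> D \<N> \<Longrightarrow> p \<bullet> n \<bullet> m \<in> D W" for n m using ap_D pn by blast
  note prev = prev_simps[OF u p]

  \<comment> \<open>Badness at all indices is carried through the induction. The interpretation
    \<open>l\<close> is supplied through the free variable \<open>le_var X\<close>, and
    \<open>u\<close> fills the quantifier over \<open>q\<close>.\<close>
  have bad_p: "\<forall>j\<in>D \<N>. bad X l (p \<bullet> n) j" if n: "n \<in> D \<N>" for n
  proof (rule nat_ind[where x = ?n and e = "dflt(le_var X := l, ?p := p)"
        and A = "\<^bold>\<forall>?j. theta X (V ?p \<cdot> V ?n) (V ?j)" and P = "\<lambda>n. \<forall>j\<in>D \<N>. bad X l (p \<bullet> n) j"])
    show "\<forall>j\<in>D \<N>. bad X l (p \<bullet> zero) j"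
      using mb[rule_format, OF _ _ u, of zero] prev(1) bad_u by simp
    show "\<forall>j\<in>D \<N>. bad X l (p \<bullet> suc m) j" if "m \<in> D \<N>" "\<forall>j\<in>D \<N>. bad X l (p \<bullet> m) j" for m
      using mb[rule_format, OF _ _ u, of "suc m"] prev(2)[OF that(1)] that by simp
    show "bv (\<^bold>\<forall>?j. theta X (V ?p \<cdot> V ?n) (V ?j)) \<inter> Par = {}"
      using bv_theta[of X "V ?p \<cdot> V ?n" "V ?j"] by (auto simp: Par_def)
  qed (use l p n in \<open>auto simp: Par_def sat_theta W_def\<close>)

  have diag: "\<forall>i\<in>D \<N>. le i n \<longrightarrow> p \<bullet> n \<bullet> i = p \<bullet> i \<bullet> i" if n: "n \<in> D \<N>" for n
  proof (rule nat_ind[where x = ?n and e = "dflt(?p := p)"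
        and A = "\<^bold>\<forall>?i. V ?i \<preceq> V ?n \<^bold>\<longrightarrow> V ?p \<cdot> V ?n \<cdot> V ?i \<doteq> V ?p \<cdot> V ?i \<cdot> V ?i"
        and P = "\<lambda>n. \<forall>i\<in>D \<N>. le i n \<longrightarrow> p \<bullet> n \<bullet> i = p \<bullet> i \<bullet> i"])
    fix m assume m: "m \<in> D \<N>" and IH: "\<forall>i\<in>D \<N>. le i m \<longrightarrow> p \<bullet> m \<bullet> i = p \<bullet> i \<bullet> i"
    \<comment> \<open>The segments have length m + 1, so the agreement includes index m, where the
      new diagonal value of \<open>p m\<close> sits.\<close>
    have "?init \<bullet> (p \<bullet> m) \<bullet> suc m = ?init \<bullet> (p \<bullet> suc m) \<bullet> suc m"
      using mb[rule_format, OF _ _ u, of "suc m" zero] prev(2)[OF m] m by simp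
    then have step: "\<forall>i\<in>D \<N>. lt i (suc m) \<longrightarrow> p \<bullet> m \<bullet> i = p \<bullet> suc m \<bullet> i"
      using init_eq_iff[of "p \<bullet> m" W "p \<bullet> suc m" "suc m"] m by simp
    show "\<forall>i\<in>D \<N>. le i (suc m) \<longrightarrow> p \<bullet> suc m \<bullet> i = p \<bullet> i \<bullet> i"
    proof (intro ballI impI)
      fix i assume i: "i \<in> D \<N>" "le i (suc m)"
      then consider "le i m" | "i = suc m" using le_cases[of i "suc m"] m by auto
      then show "p \<bullet> suc m \<bullet> i = p \<bullet> i \<bullet> i"
      proof cases
        case 1
        then have "p \<bullet> m \<bullet> i = p \<bullet> suc m \<bullet> i" using step i(1) m by simp
        then show ?thesis using IH i(1) 1 by simp
      qed simp
    qed
  qed (use p n in \<open>auto simp: Par_def\<close>)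

  \<comment> \<open>Both diagonal entries occur in the single bad sequence \<open>p k\<close>, at
    positions i and k, so badness up to index k suffices.\<close>
  have not_emb: False if "i \<in> D \<N>" "k \<in> D \<N>" "lt i k" "emb X l (p \<bullet> i \<bullet> i) (p \<bullet> k \<bullet> k)" for i k
  proof -
    have "p \<bullet> k \<bullet> i = p \<bullet> i \<bullet> i" using diag that lt_le by blast
    moreover have "\<not> emb X l (p \<bullet> k \<bullet> i) (p \<bullet> k \<bullet> k)"
      using bad_p[OF that(2)] that unfolding bad_def by (meson le_simps(2))
    ultimately show False using that by simp
  qed

  define w where "w n = val (butlast_t X) \<bullet> (p \<bullet> n \<bullet> n)" for n
  define x where "x n = val (last_t X) \<bullet> (p \<bullet> n \<bullet> n)" for n
  have wD: "n \<in> D \<N> \<Longrightarrow> w n \<in> D (X\<^sup>\<star>)" and xD: "n \<in> D \<N> \<Longrightarrow> x n \<in> D X" for n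
    using pnm[of n n] by (simp_all add: w_def x_def W_def)
  have split: "p \<bullet> n \<bullet> n = ext X (w n) (x n)" if n: "n \<in> D \<N>" for n
  proof -
    have "p \<bullet> n \<bullet> n \<noteq> cn (Empty X)"
    proof
      assume "p \<bullet> n \<bullet> n = cn (Empty X)"
      \<comment> \<open>An empty diagonal entry would embed into its successor.\<close>
      then have "emb X l (p \<bullet> n \<bullet> n) (p \<bullet> suc n \<bullet> suc n)"
        using emb_Empty[of "p \<bullet> suc n \<bullet> suc n" X l] pnm[of "suc n" "suc n"] n by (simp add: W_def)
      then show False using not_emb[of n "suc n"] n by simp
    qed
    then show ?thesis using seq_cases[of "p \<bullet> n \<bullet> n" X] pnm[OF n n] by (simp add: w_def x_def W_def)
  qed

  \<comment> \<open>\<open>x\<close> is only a HOL function, whereas \<open>Ram\<close> speaks about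
    elements of the model; \<open>xs\<close> is the element that represents it.\<close>
  define xs where "xs = ev ap cn (dflt(?p := p)) (\<^bold>\<lambda>?n. last_t X \<cdot> (V ?p \<cdot> V ?n \<cdot> V ?n))"
  have "xs \<in> D (X\<^sup>\<omega>)" unfolding xs_def using p by (intro ev_D' env_upd) (simp_all add: W_def)
  then obtain g where g: "g \<in> D (\<N> \<rightarrow> \<N>)" and "\<forall>k\<in>D \<N>. \<forall>i\<in>D \<N>. \<forall>j\<in>D \<N>. lt i j \<and> le j k \<longrightarrow>
      lt (g \<bullet> i) (g \<bullet> j) \<and> l \<bullet> (xs \<bullet> (g \<bullet> i)) \<bullet> (xs \<bullet> (g \<bullet> j)) = zero"
    using ram by blast
  moreover have gD [simp]: "n \<in> D \<N> \<Longrightarrow> g \<bullet> n \<in> D \<N>" for n using ap_D g by blast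
  moreover have "xs \<bullet> n = x n" if "n \<in> D \<N>" for n
    unfolding xs_def x_def using p that by (simp add: ev_lam W_def)
  \<comment> \<open>The bound in \<open>Ram\<close> is taken to be \<open>j\<close> itself.\<close>
  ultimately have g_mono: "lt (g \<bullet> i) (g \<bullet> j)" and g_le: "l \<bullet> x (g \<bullet> i) \<bullet> x (g \<bullet> j) = zero"
    if "i \<in> D \<N>" "j \<in> D \<N>" "lt i j" for i j
    using that by (metis le_simps(2))+
  define G where "G = g \<bullet> zero"
  have G: "G \<in> D \<N>" by (simp add: G_def)
  have G_le: "le G (g \<bullet> n)" if n: "n \<in> D \<N>" for n
    using n
  proof (cases rule: nat_cases)
    case (2 m)
    then show ?thesis using g_mono[of zero n] lt_le[of G "g \<bullet> n"] n G by (simp add: G_def)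
  qed (use G in \<open>simp add: G_def\<close>)

  txt \<open>\<open>monus G m\<close> is zero if and only if \<open>G \<le> m\<close>; only then does \<open>?s\<close> matter.\<close>
  let ?s = "V ?g \<cdot> (monus_t \<cdot> V ?m \<cdot> (V ?g \<cdot> C Zero))"
  define e where "e = dflt(?p := p, ?g := g)"
  define q where "q = ev ap cn e (\<^bold>\<lambda>?m. C (R W) \<cdot> (butlast_t X \<cdot> (V ?p \<cdot> ?s \<cdot> ?s))
    \<cdot> (\<^bold>\<lambda>?y. \<^bold>\<lambda>?k. V ?p \<cdot> V ?m \<cdot> V ?m) \<cdot> (monus_t \<cdot> (V ?g \<cdot> C Zero) \<cdot> V ?m))"
  have e: "env D e" unfolding e_def using p g by (intro env_upd env_dflt) simp_all
  have qD: "q \<in> D (W\<^sup>\<omega>)" unfolding q_def using e by (intro ev_D') (simp_all add: W_def)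
  \<comment> \<open>Position G + i carries the word \<open>w\<close> with index \<open>g\<close> at
    i; hence position G carries \<open>w G\<close>.\<close>
  have q: "q \<bullet> m = (if le G m then w (g \<bullet> monus m G) else p \<bullet> m \<bullet> m)" if m: "m \<in> D \<N>" for m
  proof -
    have e_vals: "e ?p = p" "e ?g = g" by (simp_all add: e_def)
    have "val (butlast_t X) \<bullet> (p \<bullet> (g \<bullet> monus m G) \<bullet> (g \<bullet> monus m G)) \<in> D W"
      using wD[of "g \<bullet> monus m G"] m G by (simp add: w_def W_def)
    then show ?thesis
      using m G e unfolding q_def le_def w_def
      by (simp add: ev_lam ev_cond e_vals[unfolded W_def] G_def[symmetric] W_def)
  qed

  have "?init \<bullet> q \<bullet> G = ?init \<bullet> (p \<bullet> G) \<bullet> G"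
  proof -
    have "q \<bullet> i = p \<bullet> G \<bullet> i" if i: "i \<in> D \<N>" "lt i G" for i
    proof -
      have "\<not> le G i" using not_lt[of i G] i G by blast
      then show ?thesis using q[OF i(1)] diag[OF G] lt_le[OF i(1) G i(2)] i(1) by simp
    qed
    then show ?thesis using init_eq_iff[OF qD pn[OF G] G] by blast
  qed
  moreover have "q \<bullet> G = w G" using q[OF G] G by (simp add: G_def[symmetric])
  \<comment> \<open>The suffix witnessing the proper prefix is the one-letter word made of
    \<open>x G\<close>.\<close>
  then have "p \<bullet> G \<bullet> G = val (append_t X) \<bullet> (q \<bullet> G) \<bullet> ext X (cn (Empty X)) (x G)"
    using split[OF G] wD[OF G] xD[OF G] by simp
  moreover have "ext X (cn (Empty X)) (x G) \<in> D W" "ext X (cn (Empty X)) (x G) \<noteq> cn (Empty X)"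
    using xD[OF G] by (simp_all add: W_def)
  ultimately have "\<not> bad X l q (f \<bullet> G \<bullet> q)"
    using mb[rule_format, OF G G qD] by blast
  then obtain i k where ik: "i \<in> D \<N>" "k \<in> D \<N>" "lt i k" and emb: "emb X l (q \<bullet> i) (q \<bullet> k)"
    unfolding bad_def by blast
  show False
  proof (cases "le G i")
    case True
    have Gk: "le G k" using le_trans[OF G ik(1,2) True] lt_le ik by blast
    let ?a = "monus i G" and ?b = "monus k G"
    have ab: "?a \<in> D \<N>" "?b \<in> D \<N>" using ik G by simp_all
    have lt: "lt ?a ?b" using monus_less_mono G ik True by blast
    have "emb X l (w (g \<bullet> ?a)) (w (g \<bullet> ?b))" using emb q ik True Gk by simp
    \<comment> \<open>Both positions lie in the tail: the last letters are comparable by the choice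
      of \<open>g\<close>, so they can be put back on both words.\<close>
    then have "emb X l (p \<bullet> (g \<bullet> ?a) \<bullet> (g \<bullet> ?a)) (p \<bullet> (g \<bullet> ?b) \<bullet> (g \<bullet> ?b))"
      using emb_ext_ext g_le[OF ab lt] split wD xD ab by simp
    then show False using not_emb g_mono[OF ab lt] gD ab by blast
  next
    case False
    then have iG: "lt i G" using not_lt[OF ik(1) G] by blast
    show False
    proof (cases "le G k")
      case True
      let ?b = "g \<bullet> monus k G"
      have b: "?b \<in> D \<N>" using ik G by simp
      have "emb X l (p \<bullet> i \<bullet> i) (w ?b)" using emb q ik True False by simp
      then have "emb X l (p \<bullet> i \<bullet> i) (p \<bullet> ?b \<bullet> ?b)"
        using emb_ext_right[of "p \<bullet> i \<bullet> i" X "w ?b" "x ?b" l] split[OF b] wD[OF b] xD[OF b]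
          pnm[OF ik(1) ik(1)] by (simp add: W_def)
      \<comment> \<open>Here i < G, and G is a lower bound for all values of \<open>g\<close>, so
        the pair of diagonal entries is in the right order.\<close>
      moreover have "lt i ?b" using lt_le_trans[OF ik(1) G b iG] G_le ik G by simp
      ultimately show False using not_emb ik b by blast
    next
      case k: False
      then show False using not_emb emb q ik False by simp
    qed
  qed
qed

section \<open>Reading the formal statements in a model\<close>

lemma sat_Ram: "sat D ap cn e (Ram X) \<longleftrightarrow>
    (\<forall>x\<in>D (X\<^sup>\<omega>). \<exists>g\<in>D (\<N> \<rightarrow> \<N>). \<forall>k\<in>D \<N>. \<forall>i\<in>D \<N>. \<forall>j\<in>D \<N>. lt i j \<and> le j k \<longrightarrow>
      lt (g \<bullet> i) (g \<bullet> j) \<and> e (le_var X) \<bullet> (x \<bullet> (g \<bullet> i)) \<bullet> (x \<bullet> (g \<bullet> j)) = zero)"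
  by (simp add: Ram_def Let_def leX_def)

lemma sat_WQO: "sat D ap cn e (WQO X) \<longleftrightarrow>
    (\<forall>u\<in>D ((X\<^sup>\<star>)\<^sup>\<omega>). \<exists>j\<in>D \<N>. \<not> bad X (e (le_var X)) u j)"
  by (simp add: WQO_def Let_def sat_theta)

lemma sat_MB:
  fixes X defines "W \<equiv> X\<^sup>\<star>"
  shows "sat D ap cn e (MB X) \<longleftrightarrow>
    (\<forall>u\<in>D (W\<^sup>\<omega>). \<exists>p\<in>D ((W\<^sup>\<omega>)\<^sup>\<omega>). \<exists>f\<in>D ((W\<^sup>\<omega> \<rightarrow> \<N>)\<^sup>\<omega>). \<forall>n\<in>D \<N>. \<forall>j\<in>D \<N>. \<forall>q\<in>D (W\<^sup>\<omega>).
      val (init_t W) \<bullet> (cn (R (W\<^sup>\<omega>)) \<bullet> u \<bullet> (cn (K (\<N> \<rightarrow> W\<^sup>\<omega>) (W\<^sup>\<omega>)) \<bullet> p) \<bullet> n) \<bullet> n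
        = val (init_t W) \<bullet> (p \<bullet> n) \<bullet> n \<and>
      (bad X (e (le_var X)) (cn (R (W\<^sup>\<omega>)) \<bullet> u \<bullet> (cn (K (\<N> \<rightarrow> W\<^sup>\<omega>) (W\<^sup>\<omega>)) \<bullet> p) \<bullet> n) j
        \<longrightarrow> bad X (e (le_var X)) (p \<bullet> n) j) \<and>
      (val (init_t W) \<bullet> q \<bullet> n = val (init_t W) \<bullet> (p \<bullet> n) \<bullet> n \<and>
        (\<exists>c\<in>D W. c \<noteq> cn (Empty X) \<and> p \<bullet> n \<bullet> n = val (append_t X) \<bullet> (q \<bullet> n) \<bullet> c)
        \<longrightarrow> \<not> bad X (e (le_var X)) q (f \<bullet> n \<bullet> q)))"
  by (simp add: W_def MB_def Let_def sat_theta lex_less_def proper_prefix_def prev_t_def)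

lemma sat_Ram_MB_imp_WQO:
  assumes "env D e"
  shows "sat D ap cn e (Ram X \<^bold>\<and> MB X \<^bold>\<longrightarrow> WQO X)"
proof -
  have l: "e (le_var X) \<in> D (X \<rightarrow> X \<rightarrow> \<N>)" using env_in[OF assms, of "le_var X"] by simp
  have "sat D ap cn e (WQO X)" if ram: "sat D ap cn e (Ram X)" and mb: "sat D ap cn e (MB X)"
    unfolding sat_WQO
  proof
    fix u assume u: "u \<in> D ((X\<^sup>\<star>)\<^sup>\<omega>)"
    show "\<exists>j\<in>D \<N>. \<not> bad X (e (le_var X)) u j"
      using mb[unfolded sat_MB, rule_format, OF u] wqo_of_minimal_bad[OF l ram[unfolded sat_Ram] u]
      by blast
  qed
  then show ?thesis by simp
qed

end

text \<open>The only variable that can occur free is \<open>le_var X\<close>, whose name begins with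
  the letter reserved for parameters; all bound names begin with other letters. This is what the
  choice of \<open>Par\<close> was made for.\<close>

lemma sentence_Ram_MB_imp_WQO: "sentence (Ram X \<^bold>\<and> MB X \<^bold>\<longrightarrow> WQO X)"
proof -
  have "fv (theta X v j) \<subseteq> insert (le_var X) (tfv v \<union> tfv j)" for v j
    by (auto simp: theta_def embeds_def leX_def le_fm_def less_fm_def Let_def)
  note fv_theta = this[THEN subsetD]
  have par: "le_var X \<in> Par" by (simp add: Par_def le_var_def)
  have bv_theta': "x \<in> bv (theta X v j) \<Longrightarrow> x \<notin> Par" for x v j using bv_theta by blast
  have "wff (Ram X \<^bold>\<and> MB X \<^bold>\<longrightarrow> WQO X)"
    by (simp add: Ram_def MB_def WQO_def leX_def lex_less_def proper_prefix_def prev_t_def Let_def le_var_def)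
  moreover have "fv (Ram X) \<subseteq> Par" "bv (Ram X) \<inter> Par = {}"
    using par by (auto simp: Ram_def leX_def le_fm_def less_fm_def Let_def Par_def)
  moreover have "fv (WQO X) \<subseteq> Par" "bv (WQO X) \<inter> Par = {}"
    using par by (auto simp: WQO_def Let_def dest!: fv_theta bv_theta') (auto simp: Par_def)
  moreover have "fv (MB X) \<subseteq> Par" "bv (MB X) \<inter> Par = {}"
    using par by (auto simp: MB_def lex_less_def proper_prefix_def prev_t_def Let_def
      dest!: fv_theta bv_theta') (auto simp: Par_def)
  ultimately show ?thesis by (simp add: sentence_def Int_Un_distrib2)
qed

theorem theorem3:
  fixes X :: ty
  shows "{preorder_fm X} \<turnstile> Ram X \<^bold>\<and> MB X \<^bold>\<longrightarrow> WQO X"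
proof (rule pa.Weaken)
  show "{} \<turnstile> Ram X \<^bold>\<and> MB X \<^bold>\<longrightarrow> WQO X"
    using sentence_Ram_MB_imp_WQO by (rule completeness) (rule pa_model.sat_Ram_MB_imp_WQO)
qed simp

end
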